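(* Let $a\in H^1(\mathbb{R})\cap L^1(\mathbb{R})$. Define $\varphi(x)=\exp\{-\frac{x^2}{4}\}$ and $\varphi_{\sigma,x_0}(x)=\varphi\bigl(\frac{x-x_0}{\sigma}\bigr)$ for $x_0\in\mathbb{R}$ and $0<\sigma\ll 1$. Then \[ \biggl|\int_0^\infty\int_{\mathbb{R}}a(x)\,|e^{it\Delta}\varphi_{\sigma,x_0}(x)|^4\,dx\,dt-\tfrac{1}{\sqrt{2}}\,\sigma^3|\log\sigma|\,a(x_0)\biggr|\lesssim \sigma^3\|a\|_{H^1}. \]
   Context: Here $\Delta=\partial_x^2$ on $\mathbb{R}$ and $e^{it\Delta}$ is the free Schrödinger propagator, defined as the Fourier multiplier operator with symbol $e^{-it\xi^2}$. The notation $A\lesssim B$ means $A\le CB$ for some constant $C>0$, and $0<\sigma\ll1$ means that $\sigma>0$ is sufficiently small. The value $a(x_0)$ refers to the continuous representative of $a\in H^1(\mathbb{R})$.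
   Formalization: The leading constant 1/√2 is replaced by √π: with Lebesgue measure dx dt the printed constant is false (e.g. a(x)=exp(-x²), x_0=0, where the difference grows like σ³|log σ|). *)

theory Defs
  imports "HOL-Analysis.Analysis"
begin

subsection \<open>The Sobolev space of order one on the line\<close>

text \<open>
  Elements of Lebesgue and Sobolev spaces are represented by Borel functions that need not be
  continuous; point values are therefore taken of \<open>continuous_rep\<close>.
\<close>

definition square_integrable :: "(real \<Rightarrow> complex) \<Rightarrow> bool" where
  "square_integrable f \<longleftrightarrow>
     f \<in> borel_measurable lborel \<and> integrable lborel (\<lambda>x. (cmod (f x))\<^sup>2)"

definition test_function :: "(real \<Rightarrow> real) \<Rightarrow> bool" where
  "test_function \<psi> \<longleftrightarrow>
     (\<forall>n x. (deriv ^^ n) \<psi> field_differentiable (at x)) \<and> compact (closure {x. \<psi> x \<noteq> 0})"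

definition locally_integrable :: "(real \<Rightarrow> complex) \<Rightarrow> bool" where
  "locally_integrable f \<longleftrightarrow> (\<forall>K. compact K \<longrightarrow> set_integrable lborel K f)"

definition has_weak_deriv :: "(real \<Rightarrow> complex) \<Rightarrow> (real \<Rightarrow> complex) \<Rightarrow> bool" where
  "has_weak_deriv f g \<longleftrightarrow> locally_integrable f \<and> locally_integrable g \<and>
     (\<forall>\<psi>. test_function \<psi> \<longrightarrow>
        (LINT x|lborel. deriv \<psi> x *\<^sub>R f x) = - (LINT x|lborel. \<psi> x *\<^sub>R g x))"

definition H1 :: "(real \<Rightarrow> complex) set" where
  "H1 = {f. square_integrable f \<and> (\<exists>g. has_weak_deriv f g \<and> square_integrable g)}"

text \<open>Weak derivatives are unique up to null sets, so the choice does not affect the norm.\<close>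

definition weak_deriv :: "(real \<Rightarrow> complex) \<Rightarrow> real \<Rightarrow> complex" where
  "weak_deriv f = (SOME g. has_weak_deriv f g \<and> square_integrable g)"

definition H1_norm :: "(real \<Rightarrow> complex) \<Rightarrow> real" where
  "H1_norm f =
     sqrt ((LINT x|lborel. (cmod (f x))\<^sup>2) + (LINT x|lborel. (cmod (weak_deriv f x))\<^sup>2))"

definition continuous_rep :: "(real \<Rightarrow> complex) \<Rightarrow> real \<Rightarrow> complex" where
  "continuous_rep f = (THE b. continuous_on UNIV b \<and> (AE x in lborel. f x = b x))"


subsection \<open>The free Schroedinger propagator\<close>

definition fourier :: "(real \<Rightarrow> complex) \<Rightarrow> real \<Rightarrow> complex" where
  "fourier f \<xi> = (1 / sqrt (2 * pi)) *\<^sub>R (LINT x|lborel. exp (- \<i> * of_real (x * \<xi>)) * f x)"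

definition inverse_fourier :: "(real \<Rightarrow> complex) \<Rightarrow> real \<Rightarrow> complex" where
  "inverse_fourier F x = (1 / sqrt (2 * pi)) *\<^sub>R (LINT \<xi>|lborel. exp (\<i> * of_real (x * \<xi>)) * F \<xi>)"

text \<open>
  Absolutely convergent integrals are used for both transforms, so for a bounded measurable symbol
  this is the multiplier operator on integrable functions with integrable Fourier transform
  (in particular on Schwartz functions, such as the Gaussians below); no extension by density is
  made.
\<close>

definition fourier_multiplier :: "(real \<Rightarrow> complex) \<Rightarrow> (real \<Rightarrow> complex) \<Rightarrow> real \<Rightarrow> complex" where
  "fourier_multiplier m f = inverse_fourier (\<lambda>\<xi>. m \<xi> * fourier f \<xi>)"

definition schroedinger :: "real \<Rightarrow> (real \<Rightarrow> complex) \<Rightarrow> real \<Rightarrow> complex" where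
  "schroedinger t = fourier_multiplier (\<lambda>\<xi>. exp (- \<i> * of_real (t * \<xi>\<^sup>2)))"


subsection \<open>The Gaussian profile\<close>

text \<open>
  The fourth power of the modulus of the evolution of \<open>gauss\<close> at time \<open>t\<close> is
  \<open>exp (- x\<^sup>2 / (1 + t\<^sup>2)) / (1 + t\<^sup>2)\<close>, with integral \<open>sqrt pi / sqrt (1 + t\<^sup>2)\<close> over the line.
  Hence, for Lebesgue measure, the coefficient of \<open>\<sigma> ^ 3 * \<bar>ln \<sigma>\<bar>\<close> in the asymptotics is
  \<open>sqrt pi\<close>; the value \<open>1 / sqrt 2 = sqrt pi / sqrt (2 * pi)\<close> printed in the literature is
  correct only if the space integral is normalised by \<open>1 / sqrt (2 * pi)\<close>.
\<close>

definition gauss :: "real \<Rightarrow> complex" where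
  "gauss x = of_real (exp (- (x\<^sup>2 / 4)))"

definition gauss_scaled :: "real \<Rightarrow> real \<Rightarrow> real \<Rightarrow> complex" where
  "gauss_scaled \<sigma> x0 x = gauss ((x - x0) / \<sigma>)"

end

theory Submission
  imports Defs "HOL-Probability.Characteristic_Functions"
begin

text \<open>
  With \<open>T = t / \<sigma>\<^sup>2\<close>, the fourth power of the modulus of the evolution is
  \<open>exp (- (x - x0)\<^sup>2 / (\<sigma>\<^sup>2 * (1 + T\<^sup>2))) / (1 + T\<^sup>2)\<close>, and the time integral is split at
  \<open>t = \<sigma>\<close>. For \<open>t > \<sigma>\<close> the Cauchy-Schwarz inequality bounds the space integral by
  \<open>\<sigma> powr (7/2) * t powr (-3/2)\<close> times the \<open>L\<^sup>2\<close> norm of \<open>a\<close>. For \<open>t \<le> \<sigma>\<close> one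
  replaces \<open>a x\<close> by \<open>a x0\<close>; since \<open>a\<close> is Hoelder continuous of order \<open>1/2\<close>, the error is at most
  \<open>\<sigma> powr (5/2) * t powr (-1/2)\<close> times the \<open>L\<^sup>2\<close> norm of the weak derivative. Both bounds integrate
  to \<open>\<sigma> ^ 3\<close>. The main term is \<open>sqrt pi * \<sigma> ^ 3 * arsinh (1 / \<sigma>) * a x0\<close>, and
  \<open>arsinh (1 / \<sigma>)\<close> differs from \<open>\<bar>ln \<sigma>\<bar>\<close> by a bounded amount.
\<close>

subsection \<open>Evolution of Gaussians\<close>

text \<open>The characteristic function of the standard normal distribution is the case
  \<open>c = 1/2\<close>; scaling the variable by \<open>sqrt (2 * c)\<close> and removing the
  density's factor \<open>1 / sqrt (2 * pi)\<close> gives every positive \<open>c\<close>.\<close>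

lemma has_bochner_integral_gaussian_fourier:
  fixes c s :: real
  assumes "c > 0"
  shows "has_bochner_integral lborel (\<lambda>x. of_real (exp (- (c * x\<^sup>2))) * exp (\<i> * of_real (s * x)))
           (of_real (sqrt (pi / c) * exp (- (s\<^sup>2 / (4 * c)))) :: complex)"
proof -
  let ?r = "sqrt (2 * c)"
  have r: "?r > 0" "?r\<^sup>2 = 2 * c" using assms by auto
  have "char std_normal_distribution t =
      (LINT x|lborel. std_normal_density x *\<^sub>R iexp (t * x))" for t
    unfolding char_def by (subst integral_density) (auto simp: normal_density_nonneg)
  then have 1: "(LINT x|lborel. std_normal_density x *\<^sub>R iexp (t * x)) = of_real (exp (- t\<^sup>2 / 2))" for t
    by (simp add: char_std_normal_distribution)
  have 2: "integrable lborel (\<lambda>x. std_normal_density x *\<^sub>R iexp (t * x))" for t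
    by (rule Bochner_Integration.integrable_bound[where f = "std_normal_density"])
       (auto simp: normal_density_nonneg)
  have "has_bochner_integral lborel (\<lambda>x. std_normal_density x *\<^sub>R iexp (s / ?r * x))
           (of_real (exp (- (s / ?r)\<^sup>2 / 2)))"
    using 1[of "s / ?r"] 2[of "s / ?r"] by (simp add: has_bochner_integral_iff)
  then have "has_bochner_integral lborel
      (\<lambda>x. std_normal_density (0 + ?r * x) *\<^sub>R iexp (s / ?r * (0 + ?r * x)))
      (of_real (exp (- (s / ?r)\<^sup>2 / 2)) /\<^sub>R \<bar>?r\<bar>)"
    using r by (subst (asm) lborel_has_bochner_integral_real_affine_iff[where c = ?r and t = 0]) simp_all
  then have "has_bochner_integral lborel
      (\<lambda>x. sqrt (2 * pi) *\<^sub>R (std_normal_density (0 + ?r * x) *\<^sub>R iexp (s / ?r * (0 + ?r * x))))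
      (sqrt (2 * pi) *\<^sub>R (of_real (exp (- (s / ?r)\<^sup>2 / 2)) /\<^sub>R \<bar>?r\<bar>))"
    by (rule has_bochner_integral_scaleR_right)
  moreover have "sqrt (2 * pi) *\<^sub>R (std_normal_density (0 + ?r * x) *\<^sub>R iexp (s / ?r * (0 + ?r * x))) =
    of_real (exp (- (c * x\<^sup>2))) * exp (\<i> * of_real (s * x))" for x
    using assms by (simp add: std_normal_density_def scaleR_conv_of_real power_mult_distrib mult.assoc
       flip: of_real_mult)
  moreover have "sqrt (2 * pi) *\<^sub>R (of_real (exp (- (s / ?r)\<^sup>2 / 2)) /\<^sub>R \<bar>?r\<bar>) =
      (of_real (sqrt (pi / c) * exp (- (s\<^sup>2 / (4 * c)))) :: complex)"
    using assms by (simp add: scaleR_conv_of_real power_divide real_sqrt_mult real_sqrt_divide field_simps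
       flip: of_real_mult)
  ultimately show ?thesis by simp
qed

lemma has_bochner_integral_gaussian:
  fixes c :: real
  assumes "c > 0"
  shows "has_bochner_integral lborel (\<lambda>x. exp (- (c * x\<^sup>2))) (sqrt (pi / c))"
proof -
  have "has_bochner_integral lborel (\<lambda>x. Re (of_real (exp (- (c * x\<^sup>2))) * exp (\<i> * of_real (0 * x))))
          (Re (of_real (sqrt (pi / c) * exp (- (0\<^sup>2 / (4 * c))))))"
    by (intro has_bochner_integral_Re has_bochner_integral_gaussian_fourier assms)
  then show ?thesis by simp
qed

text \<open>
  Taking the squared modulus avoids complex square roots and analytic continuation in \<open>z\<close>: after
  the shift \<open>\<xi> = \<eta> + d\<close> the double integral of \<open>cnj (f \<eta>) * f \<xi>\<close> factors into
  two Gaussian integrals with real coefficients.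
\<close>

lemma cmod_gaussian_fourier_complex:
  fixes z :: complex and y :: real
  assumes "Re z > 0"
  shows "(cmod (LINT \<xi>|lborel. exp (- z * of_real (\<xi>\<^sup>2)) * exp (\<i> * of_real (y * \<xi>))))\<^sup>2 =
     pi / cmod z * exp (- (y\<^sup>2 * Re z / (2 * (cmod z)\<^sup>2)))"
proof -
  define f where "f = (\<lambda>\<xi>::real. exp (- z * of_real (\<xi>\<^sup>2)) * exp (\<i> * of_real (y * \<xi>)))"
  define p where "p = Re z"
  define q where "q = Im z"
  have z: "z = Complex p q" and p: "p > 0" using assms by (simp_all add: p_def q_def)
  have cz: "(cmod z)\<^sup>2 = p\<^sup>2 + q\<^sup>2" by (simp add: cmod_power2 p_def q_def)
  have cz0: "p\<^sup>2 + q\<^sup>2 > 0" "cmod z > 0" using p by (auto simp: z sum_power2_gt_zero_iff complex_neq_0)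
  have [measurable]: "f \<in> borel_measurable borel" unfolding f_def by measurable
  have nf: "cmod (f x) = exp (- (p * x\<^sup>2))" for x
    by (simp add: f_def norm_mult p_def)
  note g = has_bochner_integral_gaussian[OF p]
  have fi: "integrable lborel f"
    by (rule Bochner_Integration.integrable_bound[OF integrable.intros[OF g]])
       (auto simp: nf)
  define h where "h = (\<lambda>(d::real, \<eta>::real). cnj (f \<eta>) * f (\<eta> + d))"
  have hm[measurable]: "h \<in> borel_measurable (lborel \<Otimes>\<^sub>M lborel)"
  proof -
    have "continuous_on UNIV f" unfolding f_def by (intro continuous_intros)
    note f = continuous_on_compose2[OF this]
    have "continuous_on UNIV h"
      unfolding h_def split_beta' by (intro continuous_on_mult continuous_on_cnj f continuous_intros) auto
    then show ?thesis using borel_measurable_continuous_onI by (simp add: lborel_prod)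
  qed
  have shift: "(LINT d|lborel. f (\<eta> + d)) = (LINT d|lborel. f d)" for \<eta>
    by (subst (2) lborel_integral_real_affine[of 1 _ \<eta>]) auto
  \<comment> \<open>Completing the square: \<open>p * (\<eta>\<^sup>2 + (\<eta> + d)\<^sup>2) = 2 *
    p * (d / 2 + \<eta>)\<^sup>2 + p / 2 * d\<^sup>2\<close>, while the squares with coefficient
    \<open>q\<close> cancel and leave the phase \<open>- 2 * q * d * (d / 2 + \<eta>)\<close>. The
    factor \<open>1 * \<eta>\<close> matches the affine substitution rule.\<close>
  have h_factor: "h (d, \<eta>) = of_real (exp (- (p / 2 * d\<^sup>2))) * exp (\<i> * of_real (y * d)) *
      (of_real (exp (- (2 * p * (d / 2 + 1 * \<eta>)\<^sup>2))) * exp (\<i> * of_real ((- 2 * q * d) * (d / 2 + 1 * \<eta>))))" for d \<eta>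
    unfolding h_def f_def z prod.case complex_cnj_mult exp_cnj exp_of_real[symmetric] mult_exp_exp
    by (rule arg_cong[where f = exp], simp add: complex_eq_iff power2_eq_square algebra_simps)
  have inner: "has_bochner_integral lborel (\<lambda>\<eta>. h (d, \<eta>))
      (of_real (exp (- (p / 2 * d\<^sup>2))) * exp (\<i> * of_real (y * d)) *
        of_real (sqrt (pi / (2 * p)) * exp (- ((- 2 * q * d)\<^sup>2 / (4 * (2 * p))))))" for d
  proof -
    have "has_bochner_integral lborel (\<lambda>x. of_real (exp (- (2 * p * x\<^sup>2))) * exp (\<i> * of_real ((- 2 * q * d) * x)))
       (of_real (sqrt (pi / (2 * p)) * exp (- ((- 2 * q * d)\<^sup>2 / (4 * (2 * p))))) :: complex)"
      by (rule has_bochner_integral_gaussian_fourier) (use p in simp)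
    then show ?thesis unfolding h_factor
      by (intro has_bochner_integral_mult_right)
       (subst (asm) lborel_has_bochner_integral_real_affine_iff[where c = 1 and t = "d/2"], simp_all)
  qed
  \<comment> \<open>The rate in \<open>d\<close> after integrating out \<open>\<eta>\<close>: the
    \<open>p / 2\<close> from completing the square plus \<open>q\<^sup>2 / (2 * p)\<close> from the
    Fourier transform of the inner Gaussian.\<close>
  define r where "r = (p\<^sup>2 + q\<^sup>2) / (2 * p)"
  have r: "r > 0" using cz0 p by (simp add: r_def)
  have inner_eq: "(LINT \<eta>|lborel. h (d, \<eta>)) =
      of_real (sqrt (pi / (2 * p))) * (of_real (exp (- (r * d\<^sup>2))) * exp (\<i> * of_real (y * d)))" for d
  proof -
    have "- (r * d\<^sup>2) = - (p / 2 * d\<^sup>2) + - ((- 2 * q * d)\<^sup>2 / (4 * (2 * p)))"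
      using p by (simp add: r_def field_simps power2_eq_square)
    then have "exp (- (r * d\<^sup>2)) = exp (- (p / 2 * d\<^sup>2)) * exp (- ((- 2 * q * d)\<^sup>2 / (4 * (2 * p))))"
      by (simp only: exp_add)
    then show ?thesis using has_bochner_integral_integral_eq[OF inner[of d]] by simp
  qed
  \<comment> \<open>Fubini needs absolute integrability: the modulus removes both phases and leaves
    a Gaussian in \<open>d\<close> times a shifted Gaussian in \<open>\<eta>\<close>.\<close>
  have hint: "integrable (lborel \<Otimes>\<^sub>M lborel) h"
  proof (rule lborel_pair.Fubini_integrable[OF hm])
    have "(LINT \<eta>|lborel. norm (h (d, \<eta>))) = exp (- (p / 2 * d\<^sup>2)) * sqrt (pi / (2 * p))" for d
    proof -
      have "has_bochner_integral lborel (\<lambda>\<eta>. exp (- (2 * p * (d / 2 + 1 * \<eta>)\<^sup>2))) (sqrt (pi / (2 * p)))"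
        using lborel_has_bochner_integral_real_affine_iff[of 1 "\<lambda>x. exp (- (2 * p * x\<^sup>2))" _ "d/2"]
          has_bochner_integral_gaussian[of "2 * p"] p by simp
      from has_bochner_integral_integral_eq[OF this] show ?thesis
        unfolding h_factor by (simp add: norm_mult)
    qed
    moreover have "integrable lborel (\<lambda>d. exp (- (p / 2 * d\<^sup>2)))"
      by (rule integrable.intros[OF has_bochner_integral_gaussian]) (use p in simp)
    ultimately show "integrable lborel (\<lambda>d. LINT \<eta>|lborel. norm (h (d, \<eta>)))" by simp
    show "AE d in lborel. integrable lborel (\<lambda>\<eta>. h (d, \<eta>))"
      using inner by (auto intro: integrable.intros)
  qed
  have "complex_of_real ((cmod (LINT x|lborel. f x))\<^sup>2) = cnj (LINT x|lborel. f x) * (LINT x|lborel. f x)"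
    by (simp only: complex_norm_square mult.commute)
  also have "\<dots> = (LINT \<eta>|lborel. cnj (f \<eta>) * (LINT d|lborel. f (\<eta> + d)))"
    by (simp add: shift)
  also have "\<dots> = (LINT \<eta>|lborel. LINT d|lborel. h (d, \<eta>))"
    by (simp add: h_def)
  also have "\<dots> = (LINT d|lborel. LINT \<eta>|lborel. h (d, \<eta>))"
    using lborel_pair.Fubini_integral[of "\<lambda>d \<eta>. h (d, \<eta>)"] hint by simp
  also have "\<dots> = of_real (sqrt (pi / (2 * p))) * of_real (sqrt (pi / r) * exp (- (y\<^sup>2 / (4 * r))))"
    unfolding inner_eq
    by (subst integral_mult_right_zero) (simp only: has_bochner_integral_integral_eq[OF has_bochner_integral_gaussian_fourier[OF r]])
  finally have "(cmod (LINT x|lborel. f x))\<^sup>2 = sqrt (pi / (2 * p)) * (sqrt (pi / r) * exp (- (y\<^sup>2 / (4 * r))))"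
    by (simp only: of_real_mult[symmetric] of_real_eq_iff)
  moreover have "sqrt (pi / (2 * p)) * sqrt (pi / r) = pi / cmod z"
  proof -
    have "sqrt (pi / (2 * p)) * sqrt (pi / r) = sqrt ((pi / cmod z)\<^sup>2)"
      unfolding real_sqrt_mult[symmetric] power_divide cz using p cz0 by (simp add: r_def power2_eq_square)
    then show ?thesis by simp
  qed
  moreover have "y\<^sup>2 / (4 * r) = y\<^sup>2 * Re z / (2 * (cmod z)\<^sup>2)"
    unfolding cz p_def[symmetric] using p cz0 by (simp add: r_def field_simps)
  ultimately show ?thesis unfolding f_def by (metis mult.assoc)
qed

text \<open>Here \<open>c = 1 / (4 * \<sigma>\<^sup>2)\<close>; translation by \<open>x0\<close>
  only adds a phase, and the unitary normalisation turns \<open>2 * \<sigma> * sqrt pi\<close> into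
  \<open>sqrt 2 * \<sigma>\<close>.\<close>

lemma fourier_gauss_scaled:
  assumes "\<sigma> > 0"
  shows "fourier (gauss_scaled \<sigma> x0) \<xi> =
    of_real (sqrt 2 * \<sigma>) * (of_real (exp (- (\<sigma>\<^sup>2 * \<xi>\<^sup>2))) * exp (- \<i> * of_real (x0 * \<xi>)))"
proof -
  have "has_bochner_integral lborel (\<lambda>x. of_real (exp (- (1 / (4 * \<sigma>\<^sup>2) * x\<^sup>2))) * exp (\<i> * of_real (- \<xi> * x)))
     (of_real (sqrt (pi / (1 / (4 * \<sigma>\<^sup>2))) * exp (- ((- \<xi>)\<^sup>2 / (4 * (1 / (4 * \<sigma>\<^sup>2)))))) :: complex)"
    by (rule has_bochner_integral_gaussian_fourier) (use assms in simp)
  then have "has_bochner_integral lborel (\<lambda>x.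
      of_real (exp (- (1 / (4 * \<sigma>\<^sup>2) * (- x0 + 1 * x)\<^sup>2))) * exp (\<i> * of_real (- \<xi> * (- x0 + 1 * x))))
     (of_real (2 * \<sigma> * sqrt pi * exp (- (\<sigma>\<^sup>2 * \<xi>\<^sup>2))) :: complex)"
    using assms by (subst (asm) lborel_has_bochner_integral_real_affine_iff[where c = 1 and t = "- x0"])
      (simp_all add: real_sqrt_mult mult_ac)
  then have "has_bochner_integral lborel (\<lambda>x. exp (- \<i> * of_real (x0 * \<xi>)) *
      (of_real (exp (- (1 / (4 * \<sigma>\<^sup>2) * (- x0 + 1 * x)\<^sup>2))) * exp (\<i> * of_real (- \<xi> * (- x0 + 1 * x)))))
     (exp (- \<i> * of_real (x0 * \<xi>)) * of_real (2 * \<sigma> * sqrt pi * exp (- (\<sigma>\<^sup>2 * \<xi>\<^sup>2))) :: complex)"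
    by (rule has_bochner_integral_mult_right)
  moreover have "exp (- \<i> * of_real (x0 * \<xi>)) *
      (of_real (exp (- (1 / (4 * \<sigma>\<^sup>2) * (- x0 + 1 * x)\<^sup>2))) * exp (\<i> * of_real (- \<xi> * (- x0 + 1 * x))))
      = exp (- \<i> * of_real (x * \<xi>)) * gauss_scaled \<sigma> x0 x" for x
    unfolding gauss_scaled_def gauss_def exp_of_real[symmetric] mult_exp_exp
    by (rule arg_cong[where f = exp]) (simp add: complex_eq_iff power_divide algebra_simps)
  ultimately have "(LINT x|lborel. exp (- \<i> * of_real (x * \<xi>)) * gauss_scaled \<sigma> x0 x) =
      exp (- \<i> * of_real (x0 * \<xi>)) * of_real (2 * \<sigma> * sqrt pi * exp (- (\<sigma>\<^sup>2 * \<xi>\<^sup>2)))"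
    using has_bochner_integral_integral_eq by fastforce
  moreover have "2 * \<sigma> * sqrt pi / sqrt (2 * pi) = sqrt 2 * \<sigma>"
    by (simp add: real_sqrt_mult real_div_sqrt field_simps)
  ultimately show ?thesis unfolding fourier_def scaleR_conv_of_real
    by (simp add: field_simps flip: of_real_mult of_real_divide)
qed

text \<open>On the Fourier side the Gaussian and the multiplier merge into
  \<open>exp (- z * \<xi>\<^sup>2)\<close> with \<open>z = \<sigma>\<^sup>2 + \<i> * t\<close>, so
  the fourth power is the square of the formula for the squared modulus; the translation turns
  \<open>x\<close> into \<open>x - x0\<close>.\<close>

lemma cmod_schroedinger_gauss_scaled:
  assumes "\<sigma> > 0"
  shows "cmod (schroedinger t (gauss_scaled \<sigma> x0) x) ^ 4 =
    \<sigma> ^ 4 / (\<sigma> ^ 4 + t\<^sup>2) * exp (- ((x - x0)\<^sup>2 * \<sigma>\<^sup>2 / (\<sigma> ^ 4 + t\<^sup>2)))"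
proof -
  define z where "z = Complex (\<sigma>\<^sup>2) t"
  let ?G = "LINT \<xi>|lborel. exp (- z * of_real (\<xi>\<^sup>2)) * exp (\<i> * of_real ((x - x0) * \<xi>))"
  have eq: "exp (\<i> * of_real (x * \<xi>)) * (exp (- \<i> * of_real (t * \<xi>\<^sup>2)) * fourier (gauss_scaled \<sigma> x0) \<xi>)
     = of_real (sqrt 2 * \<sigma>) * (exp (- z * of_real (\<xi>\<^sup>2)) * exp (\<i> * of_real ((x - x0) * \<xi>)))" for \<xi>
  proof -
    have "exp (\<i> * of_real (x * \<xi>)) * (exp (- \<i> * of_real (t * \<xi>\<^sup>2)) *
        (of_real (exp (- (\<sigma>\<^sup>2 * \<xi>\<^sup>2))) * exp (- \<i> * of_real (x0 * \<xi>)))) =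
      exp (- z * of_real (\<xi>\<^sup>2)) * exp (\<i> * of_real ((x - x0) * \<xi>))"
      unfolding exp_of_real[symmetric] mult_exp_exp z_def
      by (rule arg_cong[where f = exp]) (simp add: complex_eq_iff algebra_simps)
    then show ?thesis unfolding fourier_gauss_scaled[OF assms] by (simp only: mult_ac)
  qed
  have cz: "(cmod z)\<^sup>2 = \<sigma> ^ 4 + t\<^sup>2" by (simp add: z_def cmod_power2)
  have rz: "Re z > 0" using assms by (simp add: z_def)
  then have z0: "cmod z > 0" by (auto simp: complex_eq_iff)
  have "schroedinger t (gauss_scaled \<sigma> x0) x = of_real (\<sigma> / sqrt pi) * ?G"
    unfolding schroedinger_def fourier_multiplier_def inverse_fourier_def eq integral_mult_right_zero
    by (simp add: scaleR_conv_of_real real_sqrt_mult)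
  then have "cmod (schroedinger t (gauss_scaled \<sigma> x0) x) ^ 4 = (\<sigma> / sqrt pi) ^ 4 * ((cmod ?G)\<^sup>2)\<^sup>2"
    using assms by (simp add: norm_mult power_mult_distrib norm_divide power_divide)
  also have "\<dots> = (\<sigma> / sqrt pi) ^ 4 * (pi / cmod z * exp (- ((x - x0)\<^sup>2 * \<sigma>\<^sup>2 / (2 * (cmod z)\<^sup>2))))\<^sup>2"
    unfolding cmod_gaussian_fourier_complex[OF rz] by (simp add: z_def)
  also have "\<dots> = \<sigma> ^ 4 / (cmod z)\<^sup>2 * (exp (- ((x - x0)\<^sup>2 * \<sigma>\<^sup>2 / (2 * (cmod z)\<^sup>2))))\<^sup>2"
  proof -
    have "sqrt pi ^ 4 = pi\<^sup>2" using power_mult[of "sqrt pi" 2 2] by simp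
    then show ?thesis by (simp add: power_mult_distrib power_divide)
  qed
  also have "(exp (- ((x - x0)\<^sup>2 * \<sigma>\<^sup>2 / (2 * (cmod z)\<^sup>2))))\<^sup>2 = exp (- ((x - x0)\<^sup>2 * \<sigma>\<^sup>2 / (cmod z)\<^sup>2))"
    using z0 by (simp add: exp_double[symmetric])
  finally show ?thesis unfolding cz .
qed

subsection \<open>Smooth functions with compact support\<close>

text \<open>For \<open>k = 0\<close> this is the standard smooth function that is flat at the
  origin. The powers of \<open>1 / x\<close> are carried along because differentiation produces
  them.\<close>

definition flat_exp :: "nat \<Rightarrow> real \<Rightarrow> real" where
  "flat_exp k x = (if x \<le> 0 then 0 else exp (- (1 / x)) / x ^ k)"

text \<open>On the right, \<open>1 / x\<close> tends to infinity and the exponential beats every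
  power; on the left the function vanishes.\<close>

lemma flat_exp_tendsto_0: "(flat_exp k \<longlongrightarrow> 0) (at 0)"
proof -
  have "((\<lambda>x::real. inverse x ^ k / exp (inverse x)) \<longlongrightarrow> 0) (at_right 0)"
    by (rule filterlim_compose[OF tendsto_power_div_exp_0 filterlim_inverse_at_top_right])
  then have "(flat_exp k \<longlongrightarrow> 0) (at_right 0)"
    by (rule Lim_transform_eventually)
       (auto simp: flat_exp_def eventually_at_right_field exp_minus field_simps intro!: exI[of _ 1])
  moreover have "(flat_exp k \<longlongrightarrow> 0) (at_left 0)"
    by (rule tendsto_eventually) (auto simp: flat_exp_def eventually_at_left_field intro!: exI[of _ "-1"])
  ultimately show ?thesis by (rule filterlim_split_at_real[rotated])
qed

lemma flat_exp_has_derivative: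
  "(flat_exp k has_real_derivative (flat_exp (k + 2) x - real k * flat_exp (k + 1) x)) (at x)"
proof (cases x "0 :: real" rule: linorder_cases)
  case less
  have "((\<lambda>_. 0) has_real_derivative (flat_exp (k + 2) x - real k * flat_exp (k + 1) x)) (at x)"
    using less by (simp add: flat_exp_def)
  then show ?thesis
    by (rule has_field_derivative_transform_within[where d = "- x"]) (use less in \<open>auto simp: flat_exp_def dist_real_def\<close>)
next
  case equal
  \<comment> \<open>At the origin the difference quotient is again a member of the family,
    \<open>flat_exp (Suc k)\<close>, whose limit is known.\<close>
  have "((\<lambda>h. flat_exp k h / h) \<longlongrightarrow> 0) (at 0)"
    by (rule Lim_transform_eventually[OF flat_exp_tendsto_0[of "Suc k"]])
       (auto simp: flat_exp_def eventually_at_filter)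
  then show ?thesis using equal by (simp add: has_field_derivative_iff flat_exp_def)
next
  case greater
  have "((\<lambda>x. exp (- (1 / x)) / x ^ k) has_real_derivative (flat_exp (k + 2) x - real k * flat_exp (k + 1) x)) (at x)"
    using greater
    by (auto intro!: derivative_eq_intros simp: flat_exp_def field_simps power2_eq_square)
       (cases k, auto simp: field_simps)
  then show ?thesis
    by (rule has_field_derivative_transform_within[where d = x]) (use greater in \<open>auto simp: flat_exp_def dist_real_def\<close>)
qed

text \<open>
  Smoothness of the cutoff functions below follows from their lying in a class closed under
  differentiation.
\<close>

inductive_set flat_algebra :: "(real \<Rightarrow> real) set" where
  flat_exp: "(\<lambda>x. flat_exp k (c * x + d)) \<in> flat_algebra"
| const: "(\<lambda>x. c) \<in> flat_algebra"
| add: "f \<in> flat_algebra \<Longrightarrow> g \<in> flat_algebra \<Longrightarrow> (\<lambda>x. f x + g x) \<in> flat_algebra"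
| mult: "f \<in> flat_algebra \<Longrightarrow> g \<in> flat_algebra \<Longrightarrow> (\<lambda>x. f x * g x) \<in> flat_algebra"

lemma flat_algebra_has_derivative:
  assumes "f \<in> flat_algebra"
  shows "\<exists>f'\<in>flat_algebra. \<forall>x. (f has_real_derivative f' x) (at x)"
  using assms
proof induction
  case (flat_exp k c d)
  let ?g = "\<lambda>x. c * (flat_exp (k + 2) (c * x + d) + (- real k) * flat_exp (k + 1) (c * x + d))"
  have "?g \<in> flat_algebra" by (intro flat_algebra.intros)
  moreover have "((\<lambda>x. flat_exp k (c * x + d)) has_real_derivative ?g x) (at x)" for x
    by (rule DERIV_cong[OF DERIV_chain2[OF flat_exp_has_derivative]])
       (auto intro!: derivative_eq_intros)
  ultimately show ?case by (intro bexI[of _ ?g]) auto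
next
  case (const c)
  have "(\<lambda>x. 0) \<in> flat_algebra" by (rule flat_algebra.const)
  then show ?case by (force intro: derivative_eq_intros)
next
  case (add f g)
  then obtain f' g' where "f' \<in> flat_algebra" "g' \<in> flat_algebra"
    "\<And>x. (f has_real_derivative f' x) (at x)" "\<And>x. (g has_real_derivative g' x) (at x)" by blast
  then show ?case
    by (intro bexI[of _ "\<lambda>x. f' x + g' x"]) (auto intro!: flat_algebra.intros DERIV_add)
next
  case (mult f g)
  then obtain f' g' where "f' \<in> flat_algebra" "g' \<in> flat_algebra"
    "\<And>x. (f has_real_derivative f' x) (at x)" "\<And>x. (g has_real_derivative g' x) (at x)" by blast
  with mult.hyps show ?case
    by (intro bexI[of _ "\<lambda>x. f' x * g x + g' x * f x"]) (auto intro!: flat_algebra.intros DERIV_mult)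
qed

lemma higher_deriv_flat_algebra: "f \<in> flat_algebra \<Longrightarrow> (deriv ^^ n) f \<in> flat_algebra"
proof (induction n arbitrary: f)
  case (Suc n)
  from flat_algebra_has_derivative[OF Suc.prems] obtain f' where
    f': "f' \<in> flat_algebra" "\<And>x. (f has_real_derivative f' x) (at x)" by blast
  then have "deriv f = f'" by (intro ext DERIV_imp_deriv)
  then show ?case using Suc.IH[OF f'(1)] by (simp add: funpow_swap1)
qed simp

lemma flat_algebra_differentiable: "f \<in> flat_algebra \<Longrightarrow> f field_differentiable (at x)"
  using flat_algebra_has_derivative field_differentiable_def by blast

lemma continuous_on_flat_algebra: "f \<in> flat_algebra \<Longrightarrow> continuous_on A f"
  using flat_algebra_has_derivative by (meson DERIV_continuous_on has_field_derivative_at_within)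

text \<open>
  Stated for antiderivatives because \<open>flat_algebra\<close> is not closed under integration.
\<close>

lemma test_function_antiderivative:
  assumes "w \<in> flat_algebra" "\<And>x. (\<psi> has_real_derivative w x) (at x)" "\<And>x. x \<notin> {-M..M} \<Longrightarrow> \<psi> x = 0"
  shows "test_function \<psi>"
proof -
  have "deriv \<psi> = w" using assms(2) by (intro ext DERIV_imp_deriv)
  have "(deriv ^^ n) \<psi> field_differentiable (at x)" for n x
  proof (cases n)
    case 0
    then show ?thesis using assms(2) by (auto simp: field_differentiable_def)
  next
    case (Suc m)
    then have "(deriv ^^ n) \<psi> = (deriv ^^ m) w" by (simp add: funpow_swap1 \<open>deriv \<psi> = w\<close>)
    then show ?thesis using flat_algebra_differentiable higher_deriv_flat_algebra assms(1) by metis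
  qed
  moreover have "closure {x. \<psi> x \<noteq> 0} \<subseteq> {-M..M}"
    by (rule closure_minimal) (use assms(3) in force, simp)
  then have "compact (closure {x. \<psi> x \<noteq> 0})"
    by (meson bounded_closed_interval bounded_subset closed_closure compact_eq_bounded_closed)
  ultimately show ?thesis by (simp add: test_function_def)
qed

section \<open>Smooth bumps approximating the indicator of an open interval\<close>

definition bump :: "real \<Rightarrow> real \<Rightarrow> nat \<Rightarrow> real \<Rightarrow> real" where
  "bump u v n x = flat_exp 0 (real (Suc n) * (x - u)) * flat_exp 0 (real (Suc n) * (v - x))"

lemma bump_flat_algebra: "bump u v n \<in> flat_algebra"
proof -
  have "(\<lambda>x. flat_exp 0 (real (Suc n) * x + (- (real (Suc n) * u))) * flat_exp 0 ((- real (Suc n)) * x + real (Suc n) * v)) \<in> flat_algebra"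
    by (intro flat_algebra.intros)
  then show ?thesis by (simp add: bump_def[abs_def] algebra_simps)
qed

lemma flat_exp_0_bounds: "0 \<le> flat_exp 0 x" "flat_exp 0 x \<le> 1"
  by (auto simp: flat_exp_def)

lemma bump_bounds: "0 \<le> bump u v n x" "bump u v n x \<le> indicator {u<..<v} x"
proof -
  show "0 \<le> bump u v n x" by (simp add: bump_def flat_exp_0_bounds)
  show "bump u v n x \<le> indicator {u<..<v} x"
  proof (cases "x \<in> {u<..<v}")
    case True
    then show ?thesis by (simp add: bump_def mult_le_one flat_exp_0_bounds)
  next
    case False
    then have "real (Suc n) * (x - u) \<le> 0 \<or> real (Suc n) * (v - x) \<le> 0"
      by (auto simp: mult_le_0_iff)
    then show ?thesis using False by (auto simp: bump_def flat_exp_def)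
  qed
qed

lemma bump_eq_0: "x \<notin> {u<..<v} \<Longrightarrow> bump u v n x = 0"
  using bump_bounds[of u v n x] by simp

text \<open>At an interior point at distance \<open>a\<close> from an endpoint the corresponding
  factor is \<open>exp (- 1 / (Suc n * a))\<close>, which tends to 1. Using \<open>Suc n\<close>
  keeps the scale positive for every \<open>n\<close>, and outside the interval all bumps
  vanish.\<close>

lemma bump_tendsto: "(\<lambda>n. bump u v n x) \<longlonglongrightarrow> indicator {u<..<v} x"
proof (cases "x \<in> {u<..<v}")
  case True
  have *: "(\<lambda>n. flat_exp 0 (real (Suc n) * a)) \<longlonglongrightarrow> 1" if "a > 0" for a
  proof -
    have "(\<lambda>n. exp (- (1 / a * inverse (real (Suc n))))) \<longlonglongrightarrow> exp (- (1 / a * 0))"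
      by (intro tendsto_intros LIMSEQ_inverse_real_of_nat)
    then show ?thesis using that by (simp add: flat_exp_def mult_le_0_iff divide_simps mult.commute)
  qed
  have "(\<lambda>n. bump u v n x) \<longlonglongrightarrow> 1 * 1"
    unfolding bump_def using True by (intro tendsto_mult *) auto
  then show ?thesis using True by simp
next
  case False
  then show ?thesis by (simp add: bump_eq_0)
qed

lemma continuous_bump: "continuous_on A (bump u v n)"
  by (rule continuous_on_flat_algebra[OF bump_flat_algebra])

lemma borel_measurable_bump[measurable]: "bump u v n \<in> borel_measurable borel"
  by (intro borel_measurable_continuous_onI continuous_bump)

text \<open>Dominated convergence with the cutoff of \<open>b\<close> to the interval as majorant.
  This carries identities tested against smooth functions over to integrals over intervals.\<close>

lemma bump_integral:
  fixes b :: "real \<Rightarrow> 'a::{banach, second_countable_topology}"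
  assumes b: "set_integrable lborel {u<..<v} b"
  shows "integrable lborel (\<lambda>x. bump u v n x *\<^sub>R b x)"
    "(\<lambda>n. LINT x|lborel. bump u v n x *\<^sub>R b x) \<longlonglongrightarrow> (LINT x:{u<..<v}|lborel. b x)"
proof -
  let ?f = "\<lambda>x. indicator {u<..<v} x *\<^sub>R b x"
  have i: "integrable lborel ?f" using b by (simp add: set_integrable_def)
  \<comment> \<open>Nothing is known about \<open>b\<close> outside the interval, so measurability
    and bounds are derived for its cutoff \<open>?f\<close>.\<close>
  have eq: "bump u v n x *\<^sub>R b x = bump u v n x *\<^sub>R ?f x" for n x
    by (cases "x \<in> {u<..<v}") (auto simp: bump_eq_0)
  have m[measurable]: "?f \<in> borel_measurable lborel" using i by (rule borel_measurable_integrable)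
  have m': "(\<lambda>x. bump u v n x *\<^sub>R b x) \<in> borel_measurable lborel" for n unfolding eq by measurable
  have bd: "norm (bump u v n x *\<^sub>R b x) \<le> norm (?f x)" for n x
    using bump_bounds[of u v n x]
    by (cases "x \<in> {u<..<v}") (auto simp: bump_eq_0 intro: mult_left_le_one_le)
  show "integrable lborel (\<lambda>x. bump u v n x *\<^sub>R b x)" for n
    by (rule Bochner_Integration.integrable_bound[OF i m']) (use bd in auto)
  show "(\<lambda>n. LINT x|lborel. bump u v n x *\<^sub>R b x) \<longlonglongrightarrow> (LINT x:{u<..<v}|lborel. b x)"
    unfolding set_lebesgue_integral_def
    by (rule integral_dominated_convergence[where w = "\<lambda>x. norm (?f x)"])
       (use i m' bd integrable_norm[OF i] in \<open>auto intro!: tendsto_scaleR bump_tendsto simp del: norm_scaleR\<close>)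
qed

text \<open>Open intervals form an intersection-stable generator of the Borel sets, so by a Dynkin
  argument the integral vanishes over every Borel set, and uniqueness of densities gives the
  claim.\<close>

lemma AE_zero_if_interval_integrals_zero:
  fixes f :: "real \<Rightarrow> complex"
  assumes li: "locally_integrable f"
    and zero: "\<And>u v. u < v \<Longrightarrow> (LINT x:{u<..<v}|lborel. f x) = 0"
  shows "AE x in lborel. f x = 0"
proof -
  have borel: "sets borel = sigma_sets UNIV (range (\<lambda>(u, v). {u<..<v::real}))"
  proof -
    have "(box :: real \<Rightarrow> real \<Rightarrow> real set) = greaterThanLessThan" by (simp add: fun_eq_iff)
    then show ?thesis by (subst borel_eq_box) simp
  qed
  have stable: "Int_stable (range (\<lambda>(u, v). {u<..<v::real}))"
    by (auto simp: Int_stable_def)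
  have subset_Pow: "range (\<lambda>(u, v). {u<..<v::real}) \<subseteq> Pow UNIV" by simp
  \<comment> \<open>Local integrability does not make \<open>f\<close> integrable on the line, so
    the argument runs on each bounded interval; countably many of them cover the line.\<close>
  have "AE x in lborel. \<forall>N. indicator {- real N<..<real N} x *\<^sub>R f x = 0"
  proof (subst AE_all_countable, intro allI)
    fix N :: nat
    let ?I = "{- real N<..<real N}"
    let ?f = "\<lambda>x. indicator ?I x *\<^sub>R f x"
    have "set_integrable lborel {- real N..real N} f" using li by (simp add: locally_integrable_def)
    then have "set_integrable lborel ?I f" by (rule set_integrable_subset) auto
    then have i: "integrable lborel ?f" by (simp add: set_integrable_def)
    have "(LINT x:A|lborel. ?f x) = 0" if "A \<in> sigma_sets UNIV (range (\<lambda>(u, v). {u<..<v::real}))" for A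
      using stable subset_Pow that
    proof (induction rule: sigma_sets_induct_disjoint)
      case (basic A)
      then obtain u v where A: "A = {u<..<v}" by auto
      have "(LINT x:A|lborel. ?f x) = (LINT x:{max u (- real N)<..<min v (real N)}|lborel. f x)"
        unfolding set_lebesgue_integral_def A
        by (intro Bochner_Integration.integral_cong) (auto simp: indicator_def)
      also have "\<dots> = 0"
      proof (cases "max u (- real N) < min v (real N)")
        case True
        then show ?thesis by (rule zero)
      next
        case False
        then have "{max u (- real N)<..<min v (real N)} = {}"
          by (simp only: not_less greaterThanLessThan_empty)
        then show ?thesis by (simp add: set_lebesgue_integral_def)
      qed
      finally show ?case .
    next
      case empty
      then show ?case by (simp add: set_lebesgue_integral_def)
    next
      case (compl A)
      have A: "A \<in> sets lborel" using compl(1) by (simp add: borel)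
      \<comment> \<open>For \<open>N = 0\<close> the interval is empty and \<open>zero\<close>,
        which asks for \<open>u < v\<close>, does not apply.\<close>
      have whole: "(LINT x|lborel. ?f x) = 0"
        using zero[of "- real N" "real N"] by (cases "N = 0") (auto simp: set_lebesgue_integral_def)
      have "(LINT x:UNIV - A|lborel. ?f x) = (LINT x|lborel. ?f x - indicator A x *\<^sub>R ?f x)"
        unfolding set_lebesgue_integral_def
        by (intro Bochner_Integration.integral_cong) (auto simp: indicator_def)
      also have "\<dots> = (LINT x|lborel. ?f x) - (LINT x:A|lborel. ?f x)"
        unfolding set_lebesgue_integral_def
        by (intro Bochner_Integration.integral_diff i integrable_mult_indicator A)
      finally show ?case using whole compl by simp
    next
      case (union A)
      have A: "A i \<in> sets lborel" for i using union(2) by (auto simp: borel)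
      have "(LINT x:(\<Union>(range A))|lborel. ?f x) = (\<Sum>i. LINT x:A i|lborel. ?f x)"
        by (rule lebesgue_integral_countable_add)
           (use A union(1) i in \<open>auto simp: disjoint_family_on_def set_integrable_def simp del: scaleR_scaleR
             intro!: integrable_mult_indicator\<close>)
      then show ?case using union(3) by simp
    qed
    then have "AE x in lborel. ?f x = (\<lambda>_. 0) x"
      by (intro sigma_finite_measure.density_unique_banach[OF sigma_finite_lborel i])
         (auto simp: borel)
    then show "AE x in lborel. ?f x = 0" by simp
  qed
  then show ?thesis
  proof eventually_elim
    case (elim x)
    obtain N where "\<bar>x\<bar> < real N" using reals_Archimedean2 by blast
    then have "indicator {- real N<..<real N} x = (1::real)" by (auto simp: abs_less_iff)
    with elim show ?case by (metis scaleR_one)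
  qed
qed

subsection \<open>The continuous representative\<close>

lemma Cauchy_Schwarz_integral:
  fixes f g :: "'a \<Rightarrow> real"
  assumes [measurable]: "f \<in> borel_measurable M" "g \<in> borel_measurable M"
    and f: "integrable M (\<lambda>x. (f x)\<^sup>2)" and g: "integrable M (\<lambda>x. (g x)\<^sup>2)"
  shows "integrable M (\<lambda>x. f x * g x)"
    and "(LINT x|M. \<bar>f x * g x\<bar>) \<le> sqrt (LINT x|M. (f x)\<^sup>2) * sqrt (LINT x|M. (g x)\<^sup>2)"
proof -
  have "\<bar>a * b\<bar> \<le> a\<^sup>2 + b\<^sup>2" for a b :: real
  proof -
    have "0 \<le> \<bar>a\<bar> * \<bar>b\<bar>" "2 * \<bar>a\<bar> * \<bar>b\<bar> \<le> a\<^sup>2 + b\<^sup>2"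
      using sum_squares_bound[of "\<bar>a\<bar>" "\<bar>b\<bar>"] by simp_all
    then show ?thesis unfolding abs_mult by linarith
  qed
  then show i: "integrable M (\<lambda>x. f x * g x)"
    by (intro Bochner_Integration.integrable_bound[OF Bochner_Integration.integrable_add[OF f g]]) auto
  \<comment> \<open>The inequality is applied to extended nonnegative integrals of absolute values;
    integrability of the product and of both squares then turns each of them into a real
    integral.\<close>
  have "(\<integral>\<^sup>+ x. ennreal \<bar>f x\<bar> * ennreal \<bar>g x\<bar> \<partial>M)\<^sup>2 \<le>
      (\<integral>\<^sup>+ x. (ennreal \<bar>f x\<bar>)\<^sup>2 \<partial>M) * (\<integral>\<^sup>+ x. (ennreal \<bar>g x\<bar>)\<^sup>2 \<partial>M)"
    by (rule Cauchy_Schwarz_nn_integral) auto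
  also have "(\<integral>\<^sup>+ x. ennreal \<bar>f x\<bar> * ennreal \<bar>g x\<bar> \<partial>M) = ennreal (LINT x|M. \<bar>f x * g x\<bar>)"
    using integrable_abs[OF i] by (subst nn_integral_eq_integral[symmetric]) (auto simp: ennreal_mult abs_mult)
  also have "(\<integral>\<^sup>+ x. (ennreal \<bar>f x\<bar>)\<^sup>2 \<partial>M) = ennreal (LINT x|M. (f x)\<^sup>2)"
    using f by (subst nn_integral_eq_integral[symmetric]) (auto simp: ennreal_power)
  also have "(\<integral>\<^sup>+ x. (ennreal \<bar>g x\<bar>)\<^sup>2 \<partial>M) = ennreal (LINT x|M. (g x)\<^sup>2)"
    using g by (subst nn_integral_eq_integral[symmetric]) (auto simp: ennreal_power)
  finally have "(LINT x|M. \<bar>f x * g x\<bar>)\<^sup>2 \<le> (LINT x|M. (f x)\<^sup>2) * (LINT x|M. (g x)\<^sup>2)"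
    by (simp add: ennreal_power ennreal_mult[symmetric])
  then have "(LINT x|M. \<bar>f x * g x\<bar>) \<le> sqrt ((LINT x|M. (f x)\<^sup>2) * (LINT x|M. (g x)\<^sup>2))"
    by (rule real_le_rsqrt)
  then show "(LINT x|M. \<bar>f x * g x\<bar>) \<le> sqrt (LINT x|M. (f x)\<^sup>2) * sqrt (LINT x|M. (g x)\<^sup>2)"
    by (simp add: real_sqrt_mult)
qed

text \<open>The difference of indicators encodes the signed integral from 0 to \<open>x\<close>, so
  negative \<open>x\<close> needs no separate case.\<close>

definition primitive :: "(real \<Rightarrow> complex) \<Rightarrow> real \<Rightarrow> complex" where
  "primitive g x = (LINT s|lborel. (indicator {..x} s - indicator {..0} s) *\<^sub>R g s)"

lemma set_integrable_locally_integrable: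
  assumes "locally_integrable g" "A \<in> sets borel" "A \<subseteq> {a..b}"
  shows "set_integrable lborel A g"
proof (rule set_integrable_subset)
  show "set_integrable lborel {a..b} g" using assms(1) by (simp add: locally_integrable_def)
qed (use assms in auto)

lemma continuous_imp_locally_integrable:
  assumes "continuous_on UNIV f"
  shows "locally_integrable f"
  unfolding locally_integrable_def set_integrable_def
  by (intro allI impI borel_integrable_compact continuous_on_subset[OF assms subset_UNIV])

lemma primitive_diff:
  assumes g: "locally_integrable g" and "x \<le> y"
  shows "primitive g y - primitive g x = (LINT s:{x<..y}|lborel. g s)"
proof -
  have i: "integrable lborel (\<lambda>s. (indicator {..z} s - indicator {..0} s) *\<^sub>R g s)" for z :: real
  proof -
    \<comment> \<open>Both half-open intervals are bounded and at most one is nonempty, so local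
      integrability suffices.\<close>
    have "integrable lborel (\<lambda>s. indicator {0<..z} s *\<^sub>R g s - indicator {z<..0} s *\<^sub>R g s)"
      using set_integrable_locally_integrable[OF g, of "{0<..z}" 0 z]
        set_integrable_locally_integrable[OF g, of "{z<..0}" z 0]
      by (intro Bochner_Integration.integrable_diff) (auto simp: set_integrable_def subset_eq)
    also have "(\<lambda>s. indicator {0<..z} s *\<^sub>R g s - indicator {z<..0} s *\<^sub>R g s) =
        (\<lambda>s. (indicator {..z} s - indicator {..0} s) *\<^sub>R g s)"
      by (auto simp: fun_eq_iff indicator_def)
    finally show ?thesis .
  qed
  have "primitive g y - primitive g x = (LINT s|lborel. (indicator {..y} s - indicator {..0} s) *\<^sub>R g s -
      (indicator {..x} s - indicator {..0} s) *\<^sub>R g s)"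
    unfolding primitive_def by (rule Bochner_Integration.integral_diff[symmetric, OF i i])
  also have "\<dots> = (LINT s:{x<..y}|lborel. g s)"
    unfolding set_lebesgue_integral_def using assms(2)
    by (intro Bochner_Integration.integral_cong) (auto simp: indicator_def)
  finally show ?thesis .
qed

lemma continuous_on_half_Hoelder:
  fixes f :: "real \<Rightarrow> complex"
  assumes "\<And>x y. cmod (f x - f y) \<le> K * sqrt \<bar>x - y\<bar>"
  shows "continuous_on UNIV f"
proof -
  have "((\<lambda>x. f x - f y) \<longlongrightarrow> 0) (at y)" for y
  proof (rule Lim_null_comparison)
    have "((\<lambda>x. K * sqrt \<bar>x - y\<bar>) \<longlongrightarrow> K * sqrt \<bar>y - y\<bar>) (at y)"
      by (intro tendsto_intros)
    then show "((\<lambda>x. K * sqrt \<bar>x - y\<bar>) \<longlongrightarrow> 0) (at y)" by simp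
  qed (use assms in simp)
  then show ?thesis by (simp add: continuous_on_def LIM_zero_iff)
qed

text \<open>Cauchy-Schwarz against the indicator of the interval between the two points, whose
  \<open>L\<^sup>2\<close> norm is the root of its length.\<close>

lemma primitive_Hoelder:
  assumes g: "locally_integrable g" "square_integrable g"
  shows "cmod (primitive g x - primitive g y) \<le> sqrt (LINT s|lborel. (cmod (g s))\<^sup>2) * sqrt \<bar>x - y\<bar>"
proof -
  have *: "cmod (primitive g y - primitive g x) \<le> sqrt (LINT s|lborel. (cmod (g s))\<^sup>2) * sqrt \<bar>x - y\<bar>"
    if "x \<le> y" for x y
  proof -
    have [measurable]: "g \<in> borel_measurable borel" using g(2) by (simp add: square_integrable_def)
    have ind: "(indicator {x<..y} s)\<^sup>2 = (indicator {x<..y} s :: real)" for s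
      by (simp add: indicator_def)
    have "cmod (primitive g y - primitive g x) \<le> (LINT s|lborel. \<bar>cmod (g s) * indicator {x<..y} s\<bar>)"
      unfolding primitive_diff[OF g(1) that] set_lebesgue_integral_def
      by (rule order_trans[OF integral_norm_bound]) (simp add: abs_mult mult.commute)
    also have "\<dots> \<le> sqrt (LINT s|lborel. (cmod (g s))\<^sup>2) * sqrt (LINT s|lborel. (indicator {x<..y} s)\<^sup>2)"
      using g(2) by (intro Cauchy_Schwarz_integral) (auto simp: square_integrable_def ind intro!: integrable_real_indicator emeasure_bounded_finite)
    also have "(LINT s|lborel. (indicator {x<..y} s)\<^sup>2) = \<bar>x - y\<bar>"
      using that by (simp add: ind)
    finally show ?thesis .
  qed
  show ?thesis
    using *[of x y] *[of y x] by (cases "x \<le> y") (auto simp: norm_minus_commute abs_minus_commute)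
qed

text \<open>Fubini replaces a product rule, since \<open>g\<close> need not be continuous: the
  primitive is written as an integral over \<open>s \<le> x\<close>, and after exchanging the order
  the integral of \<open>w\<close> from \<open>s\<close> to \<open>M\<close> equals
  \<open>- \<psi> s\<close>.\<close>

lemma primitive_integral_by_parts:
  fixes w \<psi> :: "real \<Rightarrow> real"
  assumes g: "locally_integrable g" and w: "continuous_on UNIV w"
    and \<psi>: "\<And>x. (\<psi> has_real_derivative w x) (at x)"
    and supp: "\<And>x. M \<le> \<bar>x\<bar> \<Longrightarrow> w x = 0" "\<And>x. M \<le> \<bar>x\<bar> \<Longrightarrow> \<psi> x = 0" and M: "M \<ge> 0"
  shows "(LINT x|lborel. w x *\<^sub>R primitive g x) = - (LINT x|lborel. \<psi> x *\<^sub>R g x)"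
proof -
  define G where "G = (\<lambda>s. indicator {-M<..M} s *\<^sub>R g s)"
  have G: "integrable lborel G"
    using set_integrable_locally_integrable[OF g, of "{-M<..M}" "-M" M]
    by (auto simp: G_def set_integrable_def subset_eq)
  have [measurable]: "w \<in> borel_measurable borel" using w by (rule borel_measurable_continuous_onI)
  have [measurable]: "G \<in> borel_measurable borel" using borel_measurable_integrable[OF G] by simp
  have FTC: "has_bochner_integral lborel (\<lambda>x. indicator {s..M} x *\<^sub>R w x) (- \<psi> s)" if "s \<le> M" for s
    using has_bochner_integral_FTC_Icc[OF that, of \<psi> w] \<psi> continuous_on_subset[OF w subset_UNIV] supp(2)[of M] M
    by (auto simp: has_real_derivative_iff_has_vector_derivative
        intro: has_vector_derivative_at_within)
  have "has_bochner_integral lborel (\<lambda>x. indicator {-M..M} x *\<^sub>R w x) 0"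
    using FTC[of "-M"] supp(2)[of "-M"] M by simp
  moreover have "indicator {-M..M} x *\<^sub>R w x = w x" for x
    using supp(1)[of x] by (cases "x \<in> {-M..M}"; cases "M \<le> \<bar>x\<bar>") auto
  then have "(\<lambda>x. indicator {-M..M} x *\<^sub>R w x) = w" ..
  ultimately have w0: "has_bochner_integral lborel w 0" by (simp only:)
  define H where "H = (\<lambda>(x, s). (w x * indicator {s..} x) *\<^sub>R G s)"
  have Hm[measurable]: "H \<in> borel_measurable (lborel \<Otimes>\<^sub>M lborel)"
  proof -
    have "H = (\<lambda>p. (w (fst p) * (if snd p \<le> fst p then 1 else 0)) *\<^sub>R G (snd p))"
      by (auto simp: H_def indicator_def)
    also have "\<dots> \<in> borel_measurable (lborel \<Otimes>\<^sub>M lborel)" by measurable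
    finally show ?thesis .
  qed
  have H: "integrable (lborel \<Otimes>\<^sub>M lborel) H"
  proof (rule Bochner_Integration.integrable_bound[OF _ Hm])
    show "integrable (lborel \<Otimes>\<^sub>M lborel) (\<lambda>(x, s). w x *\<^sub>R G s)"
      using w0 G by (intro lborel_pair.Fubini_integrable) (auto simp: has_bochner_integral_iff)
    show "AE p in lborel \<Otimes>\<^sub>M lborel. norm (H p) \<le> norm (case p of (x, s) \<Rightarrow> w x *\<^sub>R G s)"
      by (auto simp: H_def indicator_def)
  qed
  \<comment> \<open>The base point moves to \<open>-M\<close>, the left end of the range where
    \<open>w\<close> can be nonzero; the constant \<open>primitive g (-M)\<close> drops out later
    because \<open>w\<close> has integral zero.\<close>
  have 1: "w x *\<^sub>R primitive g x = w x *\<^sub>R primitive g (-M) + (LINT s|lborel. H (x, s))" for x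
  proof (cases "\<bar>x\<bar> \<ge> M")
    case True
    then show ?thesis using supp(1)[of x] by (simp add: H_def)
  next
    case False
    then have "primitive g x - primitive g (-M) = (LINT s:{-M<..x}|lborel. g s)"
      by (intro primitive_diff[OF g]) auto
    also have "w x *\<^sub>R \<dots> = (LINT s|lborel. H (x, s))"
      unfolding set_lebesgue_integral_def integral_scaleR_right[symmetric] using False
      by (intro Bochner_Integration.integral_cong) (auto simp: H_def G_def indicator_def)
    finally show ?thesis by (simp add: algebra_simps)
  qed
  have 2: "(LINT x|lborel. H (x, s)) = - (\<psi> s *\<^sub>R g s)" for s
  proof (cases "s \<in> {-M<..M}")
    case True
    then have "(LINT x|lborel. H (x, s)) = (LINT x|lborel. (indicator {s..M} x *\<^sub>R w x) *\<^sub>R G s)"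
      using supp(1) by (intro Bochner_Integration.integral_cong) (auto simp: H_def indicator_def)
    also have "\<dots> = (- \<psi> s) *\<^sub>R G s"
      by (intro has_bochner_integral_integral_eq has_bochner_integral_scaleR_left FTC) (use True in simp)
    finally show ?thesis using True by (simp add: G_def)
  next
    case False
    then show ?thesis using supp(2)[of s] by (cases "M \<le> \<bar>s\<bar>") (auto simp: H_def G_def)
  qed
  have "(LINT x|lborel. w x *\<^sub>R primitive g x) = (LINT x|lborel. w x *\<^sub>R primitive g (-M)) + (LINT x|lborel. LINT s|lborel. H (x, s))"
    unfolding 1 using w0 lborel_pair.integrable_fst'[OF H]
    by (intro Bochner_Integration.integral_add) (auto simp: has_bochner_integral_iff)
  also have "(LINT x|lborel. w x *\<^sub>R primitive g (-M)) = 0"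
    using has_bochner_integral_integral_eq[OF has_bochner_integral_scaleR_left[OF w0]] by simp
  also have "(LINT x|lborel. LINT s|lborel. H (x, s)) = (LINT s|lborel. LINT x|lborel. H (x, s))"
    using lborel_pair.Fubini_integral[of "\<lambda>x s. H (x, s)"] H by simp
  also have "\<dots> = - (LINT x|lborel. \<psi> x *\<^sub>R g x)" unfolding 2 by simp
  finally show ?thesis by simp
qed

section \<open>The du Bois-Reymond lemma: weak derivatives and primitives\<close>

lemma integrable_bump: "integrable lborel (bump u v n)"
  and bump_integral_tendsto: "u \<le> v \<Longrightarrow> (\<lambda>n. LINT x|lborel. bump u v n x) \<longlonglongrightarrow> v - u"
proof -
  have i: "set_integrable lborel {u<..<v} (\<lambda>_. 1::real)"
    by (auto simp: set_integrable_def intro!: integrable_real_indicator emeasure_bounded_finite)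
  show "integrable lborel (bump u v n)" using bump_integral(1)[OF i] by simp
  show "(\<lambda>n. LINT x|lborel. bump u v n x) \<longlonglongrightarrow> v - u" if "u \<le> v"
    using bump_integral(2)[OF i] that by (simp add: set_lebesgue_integral_def)
qed

text \<open>Normalised to vanish at \<open>-M\<close>, an antiderivative is zero to the left because
  \<open>w\<close> is, and zero to the right because the total integral of \<open>w\<close> is
  zero.\<close>

lemma compactly_supported_antiderivative:
  fixes w :: "real \<Rightarrow> real"
  assumes w: "continuous_on UNIV w" and w0: "has_bochner_integral lborel w 0"
    and supp: "\<And>x. M \<le> \<bar>x\<bar> \<Longrightarrow> w x = 0" and M: "M \<ge> 0"
  obtains \<psi> where "\<And>x. (\<psi> has_real_derivative w x) (at x)" "\<And>x. M \<le> \<bar>x\<bar> \<Longrightarrow> \<psi> x = 0"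
proof -
  have "isCont w x" for x using w by (simp add: continuous_on_eq_continuous_at)
  then obtain F where F: "\<And>x. (F has_real_derivative w x) (at x)"
    using einterval_antiderivative[of "-\<infinity>" "\<infinity>" w]
    by (auto simp: has_real_derivative_iff_has_vector_derivative)
  have FTC: "(LINT s|lborel. indicator {x..y} s *\<^sub>R w s) = F y - F x" if "x \<le> y" for x y
    using that F continuous_on_subset[OF w subset_UNIV] by (intro integral_FTC_Icc)
      (auto simp: has_real_derivative_iff_has_vector_derivative
        intro: has_vector_derivative_at_within)
  show thesis
  proof
    show "((\<lambda>x. F x - F (-M)) has_real_derivative w x) (at x)" for x
      using DERIV_diff[OF F DERIV_const] by simp
    show "F x - F (-M) = 0" if "M \<le> \<bar>x\<bar>" for x
    proof (cases "x \<le> -M")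
      case True
      then have "(LINT s|lborel. indicator {x..-M} s *\<^sub>R w s) = 0"
        using supp M by (intro integral_eq_zero_AE) (auto simp: indicator_def)
      then show ?thesis using FTC[OF True] by simp
    next
      case False
      then have x: "M \<le> x" "-M \<le> x" using that M by auto
      then have "(LINT s|lborel. indicator {-M..x} s *\<^sub>R w s) = (LINT s|lborel. w s)"
      proof (intro Bochner_Integration.integral_cong)
        show "indicator {-M..x} s *\<^sub>R w s = w s" for s
          using supp[of s] x by (cases "s \<in> {-M..x}"; cases "M \<le> \<bar>s\<bar>") auto
      qed simp
      then show ?thesis using FTC[OF x(2)] has_bochner_integral_integral_eq[OF w0] by simp
    qed
  qed
qed

text \<open>The difference \<open>b\<close> of \<open>a\<close> and the primitive of
  \<open>g\<close> has weak derivative zero. Testing it with combinations of bumps of integral zero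
  and letting the bumps tend to indicators shows that \<open>b\<close> has the same mean over every
  interval, so \<open>b\<close> is constant almost everywhere.\<close>

lemma weak_deriv_primitive:
  assumes wd: "has_weak_deriv a g" and g2: "square_integrable g"
  shows "\<exists>c. AE x in lborel. a x = c + primitive g x"
proof -
  have la: "locally_integrable a" and lg: "locally_integrable g"
    and parts: "\<And>\<psi>. test_function \<psi> \<Longrightarrow>
      (LINT x|lborel. deriv \<psi> x *\<^sub>R a x) = - (LINT x|lborel. \<psi> x *\<^sub>R g x)"
    using wd by (auto simp: has_weak_deriv_def)
  have contp: "continuous_on UNIV (primitive g)"
    using primitive_Hoelder[OF lg g2] by (rule continuous_on_half_Hoelder)
  define b where "b = (\<lambda>x. a x - primitive g x)"
  have lp: "locally_integrable (primitive g)"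
    using contp by (rule continuous_imp_locally_integrable)
  then have lb: "locally_integrable b"
    using la unfolding b_def locally_integrable_def by (auto intro!: set_integral_diff)
  have si: "set_integrable lborel {u<..<v} f" if "locally_integrable f" for f u v
    using that by (rule set_integrable_locally_integrable[of _ _ u v]) auto
  \<comment> \<open>du Bois-Reymond: a combination of two bumps with integral zero is the derivative of a test function\<close>
  have key: "(LINT x|lborel. bump 0 1 n x) *\<^sub>R (LINT x|lborel. bump u v n x *\<^sub>R b x) =
      (LINT x|lborel. bump u v n x) *\<^sub>R (LINT x|lborel. bump 0 1 n x *\<^sub>R b x)" for u v n
  proof -
    define k where "k = (LINT x|lborel. bump u v n x)"
    define k0 where "k0 = (LINT x|lborel. bump 0 1 n x)"
    define w where "w = (\<lambda>x. k0 * bump u v n x + (- k) * bump 0 1 n x)"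
    define M where "M = 1 + \<bar>u\<bar> + \<bar>v\<bar>"
    have M0: "M \<ge> 0" by (simp add: M_def)
    have wA: "w \<in> flat_algebra"
      unfolding w_def by (intro flat_algebra.add flat_algebra.mult flat_algebra.const bump_flat_algebra)
    note wc = continuous_on_flat_algebra[OF wA, of UNIV]
    have w0: "has_bochner_integral lborel w 0"
      unfolding has_bochner_integral_iff w_def
      by (simp add: integrable_bump k_def k0_def)
    have wsupp: "w x = 0" if "M \<le> \<bar>x\<bar>" for x
    proof -
      have "x \<notin> {u<..<v}" "x \<notin> {0<..<1}" using that by (auto simp: M_def)
      then show ?thesis by (simp add: w_def bump_eq_0)
    qed
    obtain \<psi> where \<psi>: "\<And>x. (\<psi> has_real_derivative w x) (at x)" "\<And>x. M \<le> \<bar>x\<bar> \<Longrightarrow> \<psi> x = 0"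
      using compactly_supported_antiderivative[OF wc w0 wsupp M0] by blast
    have "test_function \<psi>"
      by (rule test_function_antiderivative[OF wA \<psi>(1), of M]) (use \<psi>(2) in auto)
    from parts[OF this] have "(LINT x|lborel. w x *\<^sub>R a x) = (LINT x|lborel. w x *\<^sub>R primitive g x)"
      using primitive_integral_by_parts[OF lg wc \<psi>(1) wsupp \<psi>(2) M0] DERIV_imp_deriv[OF \<psi>(1)] by simp
    moreover have wi: "has_bochner_integral lborel (\<lambda>x. w x *\<^sub>R f x)
       (k0 *\<^sub>R (LINT x|lborel. bump u v n x *\<^sub>R f x) - k *\<^sub>R (LINT x|lborel. bump 0 1 n x *\<^sub>R f x))"
      if "locally_integrable f" for f
    proof -
      note 1 = bump_integral(1)[OF si[OF that], of u v n] and 2 = bump_integral(1)[OF si[OF that], of 0 1 n]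
      have "has_bochner_integral lborel (\<lambda>x. k0 *\<^sub>R (bump u v n x *\<^sub>R f x) - k *\<^sub>R (bump 0 1 n x *\<^sub>R f x))
         (k0 *\<^sub>R (LINT x|lborel. bump u v n x *\<^sub>R f x) - k *\<^sub>R (LINT x|lborel. bump 0 1 n x *\<^sub>R f x))"
        using 1 2 by (intro has_bochner_integral_diff has_bochner_integral_scaleR_right has_bochner_integral_integrable)
      then show ?thesis by (simp add: w_def scaleR_left_diff_distrib scaleR_add_left)
    qed
    have "(LINT x|lborel. w x *\<^sub>R b x) = (LINT x|lborel. w x *\<^sub>R a x) - (LINT x|lborel. w x *\<^sub>R primitive g x)"
      unfolding b_def scaleR_diff_right using wi[OF la] wi[OF lp]
      by (intro Bochner_Integration.integral_diff) (auto simp: has_bochner_integral_iff)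
    ultimately have "(LINT x|lborel. w x *\<^sub>R b x) = 0" by simp
    then show ?thesis
      using has_bochner_integral_integral_eq[OF wi[OF lb]] by (simp add: k_def k0_def)
  qed
  \<comment> \<open>The unit interval is the reference for all others; having length one, its
    integral is its mean.\<close>
  define c where "c = (LINT x:{0<..<1}|lborel. b x)"
  have mean: "(LINT x:{u<..<v}|lborel. b x) = (v - u) *\<^sub>R c" if "u < v" for u v
  proof -
    have "(\<lambda>n. (LINT x|lborel. bump 0 1 n x) *\<^sub>R (LINT x|lborel. bump u v n x *\<^sub>R b x))
        \<longlonglongrightarrow> (1 - 0) *\<^sub>R (LINT x:{u<..<v}|lborel. b x)"
      by (intro tendsto_scaleR bump_integral_tendsto bump_integral(2) si lb) simp
    moreover have "(\<lambda>n. (LINT x|lborel. bump 0 1 n x) *\<^sub>R (LINT x|lborel. bump u v n x *\<^sub>R b x))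
        \<longlonglongrightarrow> (v - u) *\<^sub>R c"
      unfolding key c_def using that by (intro tendsto_scaleR bump_integral_tendsto bump_integral(2) si lb) simp
    ultimately show ?thesis using LIMSEQ_unique by fastforce
  qed
  have lc: "locally_integrable (\<lambda>_. c)"
    by (intro continuous_imp_locally_integrable continuous_on_const)
  have "AE x in lborel. b x - c = 0"
  proof (rule AE_zero_if_interval_integrals_zero)
    show "locally_integrable (\<lambda>x. b x - c)"
      using lb lc unfolding locally_integrable_def by (auto intro!: set_integral_diff)
    fix u v :: real assume uv: "u < v"
    have "(LINT x:{u<..<v}|lborel. b x - c) = (LINT x:{u<..<v}|lborel. b x) - (LINT x:{u<..<v}|lborel. c)"
      by (intro set_integral_diff si lb lc)
    also have "(LINT x:{u<..<v}|lborel. c) = (v - u) *\<^sub>R c"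
      using uv by (simp add: set_lebesgue_integral_def)
    finally show "(LINT x:{u<..<v}|lborel. b x - c) = 0" using mean[OF uv] by simp
  qed
  then have "AE x in lborel. a x = c + primitive g x"
    by eventually_elim (simp add: b_def algebra_simps)
  then show ?thesis ..
qed

text \<open>A constant plus the primitive of the weak derivative is a continuous version of
  \<open>a\<close>, and its Hoelder bound is that of the primitive.\<close>

lemma H1_continuous_rep:
  assumes a: "a \<in> H1"
  shows "AE x in lborel. a x = continuous_rep a x"
    and "continuous_on UNIV (continuous_rep a)"
    and "cmod (continuous_rep a x - continuous_rep a y) \<le>
      sqrt (LINT s|lborel. (cmod (weak_deriv a s))\<^sup>2) * sqrt \<bar>x - y\<bar>"
proof -
  define g where "g = weak_deriv a"
  have "has_weak_deriv a g \<and> square_integrable g"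
    unfolding g_def weak_deriv_def using a by (intro someI_ex[of "\<lambda>g. has_weak_deriv a g \<and> square_integrable g"]) (simp add: H1_def)
  then have g: "has_weak_deriv a g" "locally_integrable g" "square_integrable g" by (auto simp: has_weak_deriv_def)
  obtain c where c: "AE x in lborel. a x = c + primitive g x"
    using weak_deriv_primitive g by blast
  define b where "b = (\<lambda>x. c + primitive g x)"
  have hb: "cmod (b x - b y) \<le> sqrt (LINT s|lborel. (cmod (g s))\<^sup>2) * sqrt \<bar>x - y\<bar>" for x y
    using primitive_Hoelder[OF g(2,3), of x y] by (simp add: b_def)
  have cb: "continuous_on UNIV b"
    using hb by (rule continuous_on_half_Hoelder)
  have "continuous_rep a = b"
    unfolding continuous_rep_def
  proof (rule the_equality)
    show "continuous_on UNIV b \<and> (AE x in lborel. a x = b x)" using cb c by (simp add: b_def)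
    fix b' assume b': "continuous_on UNIV b' \<and> (AE x in lborel. a x = b' x)"
    \<comment> \<open>Uniqueness for \<open>THE\<close>: two continuous versions agree on a closed
      set of full measure, which is the whole line.\<close>
    have "AE x in lborel. x \<in> {x. b' x = b x}" using c b' by (auto simp: b_def)
    moreover have "closed {x. b' x = b x}" using b' cb by (intro closed_Collect_eq) auto
    ultimately have "x \<in> {x. b' x = b x}" for x
      by (intro mem_closed_if_AE_lebesgue AE_completion)
    then show "b' = b" by auto
  qed
  then show "AE x in lborel. a x = continuous_rep a x" "continuous_on UNIV (continuous_rep a)"
    "cmod (continuous_rep a x - continuous_rep a y) \<le>
      sqrt (LINT s|lborel. (cmod (weak_deriv a s))\<^sup>2) * sqrt \<bar>x - y\<bar>"
    using c cb hb by (auto simp: b_def g_def)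
qed

subsection \<open>The space-time integral\<close>

lemma integral_norm_bound_AE:
  fixes f :: "'a \<Rightarrow> 'b::{banach, second_countable_topology}"
  assumes "integrable M f" "integrable M g" "AE x in M. norm (f x) \<le> g x"
  shows "norm (LINT x|M. f x) \<le> (LINT x|M. g x)"
  using integral_norm_bound integral_mono_AE[OF integrable_norm[OF assms(1)] assms(2,3)] by (rule order_trans)

text \<open>For nonnegative integrands the gauge integral is also a Lebesgue integral. This brings
  in the explicit integrals of powers of \<open>t\<close>, including those over intervals with a
  singular or infinite end.\<close>

lemma has_bochner_integral_nonneg_has_integral:
  fixes f :: "real \<Rightarrow> real"
  assumes [measurable]: "f \<in> borel_measurable borel" "S \<in> sets borel"
    and nonneg: "\<And>x. x \<in> S \<Longrightarrow> 0 \<le> f x" and I: "(f has_integral I) S"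
  shows "has_bochner_integral lborel (\<lambda>x. indicator S x * f x) I"
proof (rule has_bochner_integral_nn_integral)
  have "(\<lambda>x. indicator S x * f x) = (\<lambda>x. if x \<in> S then f x else 0)"
    by (simp add: fun_eq_iff)
  then have "((\<lambda>x. indicator S x * f x) has_integral I) UNIV"
    using I by (simp only: has_integral_restrict_UNIV)
  then show "(\<integral>\<^sup>+ x. ennreal (indicator S x * f x) \<partial>lborel) = ennreal I"
    by (intro nn_integral_has_integral_lborel) (auto simp: nonneg indicator_def)
  show "0 \<le> I" using I nonneg by (rule has_integral_nonneg)
qed (auto simp: nonneg indicator_def)

lemma has_bochner_integral_gaussian_centred:
  fixes c x0 :: real
  assumes "c > 0"
  shows "has_bochner_integral lborel (\<lambda>x. exp (- (c * (x - x0)\<^sup>2))) (sqrt (pi / c))"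
  using lborel_has_bochner_integral_real_affine_iff[of 1 "\<lambda>x. exp (- (c * x\<^sup>2))" "sqrt (pi / c)" "- x0"]
    has_bochner_integral_gaussian[OF assms] by simp

text \<open>Trades half of the Gaussian decay for the factor \<open>sqrt \<bar>y\<bar>\<close>.\<close>

lemma sqrt_le_gaussian:
  fixes p y :: real
  assumes "p > 0"
  shows "sqrt \<bar>y\<bar> \<le> 2 * p powr (-1/4) * exp (p / 2 * y\<^sup>2)"
proof -
  \<comment> \<open>The scaling makes \<open>v ^ 4 = p * y\<^sup>2\<close>, which reduces the claim
    to the scalar inequality \<open>v \<le> 2 * exp (v ^ 4 / 2)\<close>.\<close>
  define v where "v = p powr (1/4) * sqrt \<bar>y\<bar>"
  have v: "v \<ge> 0" by (simp add: v_def)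
  have "(p powr (1/4)) ^ 4 = p" using assms by (simp add: powr_powr flip: powr_numeral)
  moreover have "sqrt \<bar>y\<bar> ^ 4 = y\<^sup>2" using power_mult[of "sqrt \<bar>y\<bar>" 2 2] by simp
  ultimately have v4: "v ^ 4 = p * y\<^sup>2" by (simp add: v_def power_mult_distrib)
  have "v \<le> 1 + v ^ 4"
  proof (cases "v \<le> 1")
    case False
    then show ?thesis using power_increasing[of 1 4 v] by simp
  qed (simp add: add_increasing2)
  also have "\<dots> \<le> 2 * exp (v ^ 4 / 2)"
    using exp_ge_add_one_self[of "v ^ 4 / 2"] by linarith
  finally have "p powr (-1/4) * v \<le> p powr (-1/4) * (2 * exp (p / 2 * y\<^sup>2))"
    by (intro mult_left_mono) (auto simp: v4)
  moreover have "p powr (-1/4) * v = sqrt \<bar>y\<bar>"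
    using assms by (simp add: v_def powr_minus flip: mult.assoc)
  ultimately show ?thesis by simp
qed

section \<open>Pointwise bounds by the Sobolev norm and the logarithm\<close>

lemma H1_square_integrable: "a \<in> H1 \<Longrightarrow> square_integrable a"
  by (simp add: H1_def)

lemma H1_norm_bounds:
  shows "sqrt (LINT x|lborel. (cmod (a x))\<^sup>2) \<le> H1_norm a"
    and "sqrt (LINT x|lborel. (cmod (weak_deriv a x))\<^sup>2) \<le> H1_norm a"
  by (auto simp: H1_norm_def)

text \<open>Within distance one of \<open>x0\<close> the Hoelder bound compares the value at
  \<open>x0\<close> with that at \<open>x\<close>; averaging the squares over the unit interval to
  the right of \<open>x0\<close> brings in the \<open>L\<^sup>2\<close> norm.\<close>

lemma continuous_rep_le_H1_norm:
  assumes a: "a \<in> H1"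
  shows "cmod (continuous_rep a x0) \<le> 2 * H1_norm a"
proof -
  define b where "b = continuous_rep a"
  define A where "A = (LINT x|lborel. (cmod (a x))\<^sup>2)"
  define G where "G = (LINT x|lborel. (cmod (weak_deriv a x))\<^sup>2)"
  have AG: "A \<ge> 0" "G \<ge> 0" by (simp_all add: A_def G_def)
  have ai: "integrable lborel (\<lambda>x. (cmod (a x))\<^sup>2)"
    using H1_square_integrable[OF a] by (simp add: square_integrable_def)
  let ?J = "indicator {x0..x0 + 1} :: real \<Rightarrow> real"
  have J: "has_bochner_integral lborel ?J 1"
    using has_bochner_integral_real_indicator[of "{x0..x0 + 1}" lborel] by simp
  have "?J x * (cmod (b x0))\<^sup>2 \<le> ?J x * (2 * G) + 2 * (cmod (b x))\<^sup>2" for x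
  proof (cases "x \<in> {x0..x0 + 1}")
    case True
    have "cmod (b x0 - b x) \<le> sqrt G * sqrt \<bar>x0 - x\<bar>"
      unfolding b_def G_def by (rule H1_continuous_rep(3)[OF a])
    also have "\<dots> \<le> sqrt G * 1" using True AG by (intro mult_left_mono) auto
    finally have "cmod (b x0) \<le> sqrt G + cmod (b x)"
      using norm_triangle_ineq2[of "b x0" "b x"] by simp
    then have "(cmod (b x0))\<^sup>2 \<le> (sqrt G + cmod (b x))\<^sup>2" by (intro power_mono) auto
    also have "\<dots> \<le> 2 * (sqrt G)\<^sup>2 + 2 * (cmod (b x))\<^sup>2"
      using sum_squares_bound[of "sqrt G" "cmod (b x)"] by (simp add: power2_sum)
    finally show ?thesis using True AG by simp
  qed simp
  moreover have "AE x in lborel. a x = b x" unfolding b_def by (rule H1_continuous_rep(1)[OF a])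
  ultimately have ae: "AE x in lborel. ?J x * (cmod (b x0))\<^sup>2 \<le> ?J x * (2 * G) + 2 * (cmod (a x))\<^sup>2" by auto
  have l: "has_bochner_integral lborel (\<lambda>x. ?J x * (cmod (b x0))\<^sup>2) (1 * (cmod (b x0))\<^sup>2)"
    by (intro has_bochner_integral_mult_left J)
  have r: "has_bochner_integral lborel (\<lambda>x. ?J x * (2 * G) + 2 * (cmod (a x))\<^sup>2) (1 * (2 * G) + 2 * A)"
    unfolding A_def using ai
    by (intro has_bochner_integral_add has_bochner_integral_mult_left has_bochner_integral_mult_right J
        has_bochner_integral_integrable)
  have "(cmod (b x0))\<^sup>2 \<le> 2 * G + 2 * A"
    using integral_mono_AE[OF integrable.intros[OF l] integrable.intros[OF r] ae]
      has_bochner_integral_integral_eq[OF l] has_bochner_integral_integral_eq[OF r] by simp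
  also have "\<dots> \<le> (2 * H1_norm a)\<^sup>2"
    using AG by (simp add: H1_norm_def power_mult_distrib flip: A_def G_def)
  finally show ?thesis unfolding b_def
    by (rule power2_le_imp_le) (simp add: H1_norm_def)
qed

text \<open>The argument of the logarithm that defines \<open>arsinh (1 / \<sigma>)\<close> lies
  between \<open>1 / \<sigma>\<close> and \<open>3 / \<sigma>\<close>, so the error is at most
  \<open>ln 3\<close>.\<close>

lemma arsinh_inverse_approx:
  fixes \<sigma> :: real
  assumes "0 < \<sigma>" "\<sigma> < 1"
  shows "\<bar>arsinh (1 / \<sigma>) - \<bar>ln \<sigma>\<bar>\<bar> \<le> 2"
proof -
  have ars: "arsinh (1 / \<sigma>) = ln (1 / \<sigma> + sqrt ((1 / \<sigma>)\<^sup>2 + 1))"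
    by (simp add: arsinh_real_def)
  have "sqrt ((1 / \<sigma>)\<^sup>2 + 1) \<le> sqrt ((2 / \<sigma>)\<^sup>2)"
  proof (rule real_sqrt_le_mono)
    have "\<sigma> ^ 4 \<le> \<sigma>\<^sup>2" using assms by (intro power_decreasing) auto
    then have "\<sigma> ^ 4 \<le> 3 * \<sigma>\<^sup>2" using zero_le_power2[of \<sigma>] by linarith
    then show "(1 / \<sigma>)\<^sup>2 + 1 \<le> (2 / \<sigma>)\<^sup>2" using assms by (simp add: power_divide field_simps)
  qed
  also have "\<dots> = 2 / \<sigma>" using assms by simp
  finally have up: "1 / \<sigma> + sqrt ((1 / \<sigma>)\<^sup>2 + 1) \<le> 3 / \<sigma>" by simp
  have lo: "1 / \<sigma> \<le> 1 / \<sigma> + sqrt ((1 / \<sigma>)\<^sup>2 + 1)" by simp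
  have pos: "0 < 1 / \<sigma>" using assms by simp
  have "arsinh (1 / \<sigma>) \<le> ln (3 / \<sigma>)"
    unfolding ars using up lo pos by (subst ln_le_cancel_iff) linarith+
  moreover have "ln (1 / \<sigma>) \<le> arsinh (1 / \<sigma>)"
    unfolding ars using lo pos by (subst ln_le_cancel_iff) linarith+
  moreover have "ln (3 / \<sigma>) = ln 3 - ln \<sigma>" "ln (1 / \<sigma>) = - ln \<sigma>"
    using assms by (simp_all add: ln_div)
  moreover have "ln \<sigma> < 0" using assms by simp
  moreover have "ln (3::real) \<le> 2" using ln_le_minus_one[of "3::real"] by simp
  ultimately show ?thesis by linarith
qed

section \<open>Spatial estimates for the quartic Gaussian density at a fixed time\<close>

definition gauss_quartic :: "real \<Rightarrow> real \<Rightarrow> real \<Rightarrow> real \<Rightarrow> real" where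
  "gauss_quartic \<sigma> x0 t x = \<sigma> ^ 4 / (\<sigma> ^ 4 + t\<^sup>2) * exp (- ((x - x0)\<^sup>2 * \<sigma>\<^sup>2 / (\<sigma> ^ 4 + t\<^sup>2)))"

context
  fixes \<sigma> x0 t p :: real
  assumes \<sigma>: "\<sigma> > 0"
  defines "p \<equiv> \<sigma>\<^sup>2 / (\<sigma> ^ 4 + t\<^sup>2)"
begin

text \<open>In terms of the rate \<open>p\<close> the amplitude is
  \<open>\<sigma>\<^sup>2 * p\<close>, so norms and moments of the density are powers of
  \<open>p\<close> up to constants and powers of \<open>\<sigma>\<close>.\<close>

lemma gauss_quartic_eq: "gauss_quartic \<sigma> x0 t x = \<sigma>\<^sup>2 * p * exp (- (p * (x - x0)\<^sup>2))"
  by (simp add: gauss_quartic_def p_def power4_eq_xxxx power2_eq_square mult_ac)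

lemma gauss_quartic_rate_pos: "p > 0"
  using \<sigma> by (simp add: p_def add_pos_nonneg)

text \<open>Dropping \<open>\<sigma> ^ 4\<close> from the denominator turns powers of
  \<open>p\<close> into pure powers of \<open>\<sigma>\<close> and \<open>t\<close>, which integrate
  explicitly in time.\<close>

lemma gauss_quartic_rate_le: "t > 0 \<Longrightarrow> p \<le> (\<sigma> / t)\<^sup>2"
  using \<sigma> by (auto simp: p_def power_divide intro!: divide_left_mono mult_pos_pos add_pos_nonneg)

lemma gauss_quartic_nonneg: "gauss_quartic \<sigma> x0 t x \<ge> 0"
  using gauss_quartic_rate_pos by (simp add: gauss_quartic_eq)

text \<open>The mass of the density, which is the source of the coefficient \<open>sqrt pi\<close>
  in the asymptotics.\<close>

lemma has_bochner_integral_gauss_quartic: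
  "has_bochner_integral lborel (gauss_quartic \<sigma> x0 t) (sqrt pi * \<sigma> ^ 3 / sqrt (\<sigma> ^ 4 + t\<^sup>2))"
proof -
  have "has_bochner_integral lborel (gauss_quartic \<sigma> x0 t) (\<sigma>\<^sup>2 * p * sqrt (pi / p))"
    unfolding gauss_quartic_eq[abs_def]
    by (intro has_bochner_integral_mult_right has_bochner_integral_gaussian_centred gauss_quartic_rate_pos)
  also have "\<sigma>\<^sup>2 * p * sqrt (pi / p) = \<sigma>\<^sup>2 * (sqrt pi * sqrt p)"
    using gauss_quartic_rate_pos by (simp add: real_sqrt_divide field_simps)
  also have "\<dots> = sqrt pi * \<sigma> ^ 3 / sqrt (\<sigma> ^ 4 + t\<^sup>2)"
    using \<sigma> by (simp add: p_def real_sqrt_divide power3_eq_cube power2_eq_square)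
  finally show ?thesis .
qed

text \<open>Squaring doubles the rate, so the squared norm is of order
  \<open>\<sigma> ^ 4 * p powr (3/2)\<close>, and the bound on \<open>p\<close> gives
  \<open>\<sigma> powr 7 * t powr (-3)\<close>.\<close>

lemma gauss_quartic_L2_bound:
  assumes "t > 0"
  shows "integrable lborel (\<lambda>x. (gauss_quartic \<sigma> x0 t x)\<^sup>2)"
    and "sqrt (LINT x|lborel. (gauss_quartic \<sigma> x0 t x)\<^sup>2) \<le> 2 * \<sigma> powr (7/2) * t powr (-3/2)"
proof -
  have eq: "(gauss_quartic \<sigma> x0 t x)\<^sup>2 = \<sigma> ^ 4 * p\<^sup>2 * exp (- (2 * p * (x - x0)\<^sup>2))" for x
    by (simp add: gauss_quartic_eq power_mult_distrib exp_double[symmetric] mult.assoc flip: power_mult)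
  have hbi: "has_bochner_integral lborel (\<lambda>x. (gauss_quartic \<sigma> x0 t x)\<^sup>2) (\<sigma> ^ 4 * p\<^sup>2 * sqrt (pi / (2 * p)))"
    unfolding eq using gauss_quartic_rate_pos
    by (intro has_bochner_integral_mult_right has_bochner_integral_gaussian_centred) simp
  then show "integrable lborel (\<lambda>x. (gauss_quartic \<sigma> x0 t x)\<^sup>2)" by (rule integrable.intros)
  have "sqrt (pi / (2 * p)) \<le> sqrt (4 / p)"
    using gauss_quartic_rate_pos pi_less_4 by (intro real_sqrt_le_mono) (simp add: field_simps)
  also have "sqrt (4 / p) = 2 * p powr (-1/2)"
    using gauss_quartic_rate_pos by (simp add: real_sqrt_divide powr_minus powr_half_sqrt field_simps)
  finally have "\<sigma> ^ 4 * p\<^sup>2 * sqrt (pi / (2 * p)) \<le> \<sigma> ^ 4 * (p\<^sup>2 * (2 * p powr (-1/2)))"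
    unfolding mult.assoc by (intro mult_left_mono) auto
  also have "p\<^sup>2 * (2 * p powr (-1/2)) = 2 * p powr (3/2)"
  proof -
    have "p powr 2 * p powr (-1/2) = p powr (3/2)" by (simp flip: powr_add)
    then show ?thesis using gauss_quartic_rate_pos by simp
  qed
  \<comment> \<open>Enlarging the factor 2 to 4 makes the right-hand side an exact square.\<close>
  also have "\<sigma> ^ 4 * (2 * p powr (3/2)) \<le> \<sigma> ^ 4 * (4 * ((\<sigma> / t)\<^sup>2) powr (3/2))"
    using gauss_quartic_rate_pos gauss_quartic_rate_le[OF assms] by (intro mult_left_mono[OF mult_mono] powr_mono2) auto
  also have "\<dots> = (2 * \<sigma> powr (7/2) * t powr (-3/2))\<^sup>2"
  proof -
    have "((\<sigma> / t)\<^sup>2) powr (3/2) = ((\<sigma> / t) powr 2) powr (3/2)" using \<sigma> assms by simp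
    also have "\<dots> = \<sigma> powr 3 * t powr (-3)"
      using \<sigma> assms by (simp only: powr_powr powr_divide) (simp add: powr_minus_divide)
    finally have "\<sigma> ^ 4 * (4 * ((\<sigma> / t)\<^sup>2) powr (3/2)) = 4 * (\<sigma> powr 4 * \<sigma> powr 3) * t powr (-3)"
      using \<sigma> by simp
    also have "\<dots> = (2 * \<sigma> powr (7/2) * t powr (-3/2))\<^sup>2"
    proof -
      have "(\<sigma> powr (7/2))\<^sup>2 = \<sigma> powr 4 * \<sigma> powr 3" "(t powr (-3/2))\<^sup>2 = t powr (-3)"
        by (simp_all add: power2_eq_square flip: powr_add)
      then show ?thesis by (simp only: power_mult_distrib) simp
    qed
    finally show ?thesis .
  qed
  finally show "sqrt (LINT x|lborel. (gauss_quartic \<sigma> x0 t x)\<^sup>2) \<le> 2 * \<sigma> powr (7/2) * t powr (-3/2)"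
    unfolding has_bochner_integral_integral_eq[OF hbi] by (rule real_le_lsqrt[rotated]) simp
qed

text \<open>After \<open>sqrt_le_gaussian\<close> a Gaussian of rate \<open>p / 2\<close> remains.
  The exponents of \<open>p\<close> add up to \<open>1 - 1/4 - 1/2 = 1/4\<close>, and the bound on
  \<open>p\<close> yields \<open>\<sigma>\<^sup>2 * (\<sigma> / t) powr (1/2)\<close>.\<close>

lemma gauss_quartic_half_moment:
  assumes "t > 0"
  shows "integrable lborel (\<lambda>x. sqrt \<bar>x - x0\<bar> * gauss_quartic \<sigma> x0 t x)"
    and "(LINT x|lborel. sqrt \<bar>x - x0\<bar> * gauss_quartic \<sigma> x0 t x) \<le> 6 * \<sigma> powr (5/2) * t powr (-1/2)"
proof -
  let ?D = "\<lambda>x. 2 * p powr (-1/4) * (\<sigma>\<^sup>2 * p) * exp (- (p / 2 * (x - x0)\<^sup>2))"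
  have le: "sqrt \<bar>x - x0\<bar> * gauss_quartic \<sigma> x0 t x \<le> ?D x" for x
  proof -
    have "sqrt \<bar>x - x0\<bar> * gauss_quartic \<sigma> x0 t x \<le> (2 * p powr (-1/4) * exp (p / 2 * (x - x0)\<^sup>2)) * gauss_quartic \<sigma> x0 t x"
      by (intro mult_right_mono sqrt_le_gaussian gauss_quartic_rate_pos gauss_quartic_nonneg)
    also have "\<dots> = 2 * p powr (-1/4) * (\<sigma>\<^sup>2 * p) * (exp (p / 2 * (x - x0)\<^sup>2) * exp (- (p * (x - x0)\<^sup>2)))"
      by (simp add: gauss_quartic_eq)
    also have "exp (p / 2 * (x - x0)\<^sup>2) * exp (- (p * (x - x0)\<^sup>2)) = exp (- (p / 2 * (x - x0)\<^sup>2))"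
      unfolding mult_exp_exp by (rule arg_cong[where f = exp]) (simp add: field_simps)
    finally show ?thesis .
  qed
  have D: "has_bochner_integral lborel ?D (2 * p powr (-1/4) * (\<sigma>\<^sup>2 * p) * sqrt (pi / (p / 2)))"
    using gauss_quartic_rate_pos by (intro has_bochner_integral_mult_right has_bochner_integral_gaussian_centred) simp
  show i: "integrable lborel (\<lambda>x. sqrt \<bar>x - x0\<bar> * gauss_quartic \<sigma> x0 t x)"
    by (rule Bochner_Integration.integrable_bound[OF integrable.intros[OF D]])
       (use le gauss_quartic_nonneg in \<open>auto simp: gauss_quartic_def[abs_def] intro!: order_trans[OF _ abs_ge_self]\<close>)
  have "(LINT x|lborel. sqrt \<bar>x - x0\<bar> * gauss_quartic \<sigma> x0 t x) \<le> 2 * p powr (-1/4) * (\<sigma>\<^sup>2 * p) * sqrt (pi / (p / 2))"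
    unfolding has_bochner_integral_integral_eq[OF D, symmetric]
    using i integrable.intros[OF D] le by (rule integral_mono)
  also have "sqrt (pi / (p / 2)) \<le> sqrt (9 / p)"
    using gauss_quartic_rate_pos pi_less_4 by (intro real_sqrt_le_mono) (simp add: field_simps)
  also have "sqrt (9 / p) = 3 * p powr (-1/2)"
    using gauss_quartic_rate_pos by (simp add: real_sqrt_divide powr_minus powr_half_sqrt field_simps)
  also have "2 * p powr (-1/4) * (\<sigma>\<^sup>2 * p) * (3 * p powr (-1/2)) = 6 * \<sigma>\<^sup>2 * p powr (1/4)"
  proof -
    have "p powr (-1/4) * p powr 1 * p powr (-1/2) = p powr (1/4)"
      by (simp only: powr_add[symmetric]) simp
    then show ?thesis using gauss_quartic_rate_pos by simp
  qed
  also have "\<dots> \<le> 6 * \<sigma>\<^sup>2 * ((\<sigma> / t)\<^sup>2) powr (1/4)"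
    using gauss_quartic_rate_pos gauss_quartic_rate_le[OF assms] by (intro mult_left_mono powr_mono2) auto
  also have "\<dots> = 6 * \<sigma> powr (5/2) * t powr (-1/2)"
  proof -
    have "((\<sigma> / t)\<^sup>2) powr (1/4) = ((\<sigma> / t) powr 2) powr (1/4)" using \<sigma> assms by simp
    also have "\<dots> = \<sigma> powr (1/2) * t powr (-1/2)"
      using \<sigma> assms by (simp only: powr_powr powr_divide) (simp add: powr_minus_divide)
    finally have "6 * \<sigma>\<^sup>2 * ((\<sigma> / t)\<^sup>2) powr (1/4) = 6 * (\<sigma> powr 2 * \<sigma> powr (1/2)) * t powr (-1/2)"
      using \<sigma> by simp
    also have "\<dots> = 6 * \<sigma> powr (5/2) * t powr (-1/2)" by (simp flip: powr_add)
    finally show ?thesis .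
  qed
  finally show "(LINT x|lborel. sqrt \<bar>x - x0\<bar> * gauss_quartic \<sigma> x0 t x) \<le> 6 * \<sigma> powr (5/2) * t powr (-1/2)"
    using gauss_quartic_rate_pos by (simp add: mult_left_mono)
qed

text \<open>Cauchy-Schwarz alone, with no comparison to the value at \<open>x0\<close>: the power
  \<open>t powr (-3/2)\<close> is integrable at infinity.\<close>

lemma gauss_quartic_integral_far:
  assumes "t > 0" "square_integrable a"
  shows "cmod (LINT x|lborel. a x * of_real (gauss_quartic \<sigma> x0 t x)) \<le>
    sqrt (LINT x|lborel. (cmod (a x))\<^sup>2) * (2 * \<sigma> powr (7/2) * t powr (-3/2))"
proof -
  have [measurable]: "a \<in> borel_measurable borel" and a2: "integrable lborel (\<lambda>x. (cmod (a x))\<^sup>2)"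
    using assms(2) by (auto simp: square_integrable_def)
  have [measurable]: "gauss_quartic \<sigma> x0 t \<in> borel_measurable borel" by (simp add: gauss_quartic_def[abs_def])
  have "cmod (LINT x|lborel. a x * of_real (gauss_quartic \<sigma> x0 t x)) \<le> (LINT x|lborel. \<bar>cmod (a x) * gauss_quartic \<sigma> x0 t x\<bar>)"
    by (rule order_trans[OF integral_norm_bound]) (simp add: norm_mult abs_mult)
  also have "\<dots> \<le> sqrt (LINT x|lborel. (cmod (a x))\<^sup>2) * sqrt (LINT x|lborel. (gauss_quartic \<sigma> x0 t x)\<^sup>2)"
    using a2 gauss_quartic_L2_bound(1)[OF assms(1)] by (intro Cauchy_Schwarz_integral) auto
  also have "\<dots> \<le> sqrt (LINT x|lborel. (cmod (a x))\<^sup>2) * (2 * \<sigma> powr (7/2) * t powr (-3/2))"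
    by (intro mult_left_mono gauss_quartic_L2_bound(2)[OF assms(1)]) simp
  finally show ?thesis .
qed

text \<open>Freezing \<open>a\<close> at \<open>x0\<close> produces the mass of the density times
  that value; the Hoelder bound controls the error by the half moment, and
  \<open>t powr (-1/2)\<close> is integrable at zero.\<close>

lemma gauss_quartic_integral_near:
  assumes "t > 0" "a \<in> H1"
  shows "cmod ((LINT x|lborel. a x * of_real (gauss_quartic \<sigma> x0 t x)) -
      of_real (sqrt pi * \<sigma> ^ 3 / sqrt (\<sigma> ^ 4 + t\<^sup>2)) * continuous_rep a x0) \<le>
    sqrt (LINT x|lborel. (cmod (weak_deriv a x))\<^sup>2) * (6 * \<sigma> powr (5/2) * t powr (-1/2))"
proof -
  define b where "b = continuous_rep a"
  define G where "G = sqrt (LINT x|lborel. (cmod (weak_deriv a x))\<^sup>2)"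
  have [measurable]: "a \<in> borel_measurable borel" and a2: "integrable lborel (\<lambda>x. (cmod (a x))\<^sup>2)"
    using H1_square_integrable[OF assms(2)] by (simp_all add: square_integrable_def)
  have [measurable]: "gauss_quartic \<sigma> x0 t \<in> borel_measurable borel" by (simp add: gauss_quartic_def[abs_def])
  have ae: "AE x in lborel. a x = b x" unfolding b_def by (rule H1_continuous_rep(1)[OF assms(2)])
  have "integrable lborel (\<lambda>x. cmod (a x) * gauss_quartic \<sigma> x0 t x)"
    using a2 gauss_quartic_L2_bound(1)[OF assms(1)] by (intro Cauchy_Schwarz_integral) auto
  then have ia: "integrable lborel (\<lambda>x. a x * of_real (gauss_quartic \<sigma> x0 t x))"
    by (rule Bochner_Integration.integrable_bound) (auto simp: norm_mult)
  have ib: "has_bochner_integral lborel (\<lambda>x. of_real (gauss_quartic \<sigma> x0 t x) * b x0)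
     (of_real (sqrt pi * \<sigma> ^ 3 / sqrt (\<sigma> ^ 4 + t\<^sup>2)) * b x0)"
    by (intro has_bochner_integral_mult_left has_bochner_integral_of_real has_bochner_integral_gauss_quartic)
  have "(LINT x|lborel. a x * of_real (gauss_quartic \<sigma> x0 t x)) -
      of_real (sqrt pi * \<sigma> ^ 3 / sqrt (\<sigma> ^ 4 + t\<^sup>2)) * b x0 =
      (LINT x|lborel. a x * of_real (gauss_quartic \<sigma> x0 t x) - of_real (gauss_quartic \<sigma> x0 t x) * b x0)"
    using ia integrable.intros[OF ib] has_bochner_integral_integral_eq[OF ib]
    by (subst Bochner_Integration.integral_diff) auto
  also have "cmod \<dots> \<le> (LINT x|lborel. G * (sqrt \<bar>x - x0\<bar> * gauss_quartic \<sigma> x0 t x))"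
  proof (rule integral_norm_bound_AE)
    show "integrable lborel (\<lambda>x. a x * of_real (gauss_quartic \<sigma> x0 t x) - of_real (gauss_quartic \<sigma> x0 t x) * b x0)"
      by (intro Bochner_Integration.integrable_diff ia integrable.intros[OF ib])
    show "integrable lborel (\<lambda>x. G * (sqrt \<bar>x - x0\<bar> * gauss_quartic \<sigma> x0 t x))"
      by (intro integrable_mult_right gauss_quartic_half_moment assms)
    have "cmod (b x * of_real (gauss_quartic \<sigma> x0 t x) - of_real (gauss_quartic \<sigma> x0 t x) * b x0) \<le>
        G * (sqrt \<bar>x - x0\<bar> * gauss_quartic \<sigma> x0 t x)" for x
    proof -
      have "b x * of_real (gauss_quartic \<sigma> x0 t x) - of_real (gauss_quartic \<sigma> x0 t x) * b x0 =
          (b x - b x0) * of_real (gauss_quartic \<sigma> x0 t x)" by (simp add: algebra_simps)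
      also have "cmod \<dots> = cmod (b x - b x0) * gauss_quartic \<sigma> x0 t x"
        using gauss_quartic_nonneg by (simp add: norm_mult)
      also have "\<dots> \<le> (G * sqrt \<bar>x - x0\<bar>) * gauss_quartic \<sigma> x0 t x"
        unfolding b_def G_def by (intro mult_right_mono H1_continuous_rep(3) assms gauss_quartic_nonneg)
      finally show ?thesis by (simp add: mult.assoc)
    qed
    with ae show "AE x in lborel. cmod (a x * of_real (gauss_quartic \<sigma> x0 t x) - of_real (gauss_quartic \<sigma> x0 t x) * b x0) \<le>
        G * (sqrt \<bar>x - x0\<bar> * gauss_quartic \<sigma> x0 t x)" by auto
  qed
  also have "\<dots> = G * (LINT x|lborel. sqrt \<bar>x - x0\<bar> * gauss_quartic \<sigma> x0 t x)" by simp
  also have "\<dots> \<le> G * (6 * \<sigma> powr (5/2) * t powr (-1/2))"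
    by (intro mult_left_mono gauss_quartic_half_moment(2) assms) (simp add: G_def)
  finally show ?thesis unfolding b_def G_def .
qed

end

section \<open>Integration in time and collection of the errors\<close>

theorem lemma3p2:
  shows "\<exists>C>0. \<exists>\<sigma>0>0. \<forall>(a :: real \<Rightarrow> complex) (x0 :: real) (\<sigma> :: real).
    a \<in> H1 \<longrightarrow> integrable lborel a \<longrightarrow> 0 < \<sigma> \<longrightarrow> \<sigma> < \<sigma>0 \<longrightarrow>
      cmod ((LINT t:{0..}|lborel. (LINT x|lborel.
                a x * of_real (cmod (schroedinger t (gauss_scaled \<sigma> x0) x) ^ 4)))
            - of_real (sqrt pi * \<sigma> ^ 3 * \<bar>ln \<sigma>\<bar>) * continuous_rep a x0)
        \<le> C * (\<sigma> ^ 3 * H1_norm a)"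
\<comment> \<open>The constant is \<open>24 = 12 + 4 + 8\<close>: times up to
  \<open>\<sigma>\<close>, times beyond \<open>\<sigma>\<close>, and the replacement of
  \<open>arsinh (1 / \<sigma>)\<close> by the logarithm. The threshold 1 is what the comparison with
  the logarithm needs.\<close>
proof (rule exI[of _ 24], rule conjI, simp, rule exI[of _ 1], intro conjI allI impI)
  fix a :: "real \<Rightarrow> complex" and x0 \<sigma> :: real
  assume a: "a \<in> H1" and \<sigma>: "0 < \<sigma>" "\<sigma> < 1"
  define A where "A = sqrt (LINT x|lborel. (cmod (a x))\<^sup>2)"
  define G where "G = sqrt (LINT x|lborel. (cmod (weak_deriv a x))\<^sup>2)"
  define N where "N = H1_norm a"
  have AGN: "A \<ge> 0" "G \<ge> 0" "A \<le> N" "G \<le> N" "N \<ge> 0"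
    using H1_norm_bounds[of a] by (auto simp: A_def G_def N_def H1_norm_def)
  define b0 where "b0 = continuous_rep a x0"
  have b0: "cmod b0 \<le> 2 * N" unfolding b0_def N_def by (rule continuous_rep_le_H1_norm[OF a])
  have a2: "square_integrable a" and [measurable]: "a \<in> borel_measurable borel"
    using H1_square_integrable[OF a] by (simp_all add: square_integrable_def)
  define I where "I = (\<lambda>t. LINT x|lborel. a x * of_real (gauss_quartic \<sigma> x0 t x))"
  have [measurable]: "I \<in> borel_measurable borel"
    unfolding I_def gauss_quartic_def by measurable
  define M where "M = (\<lambda>t. indicator {0..\<sigma>} t * (sqrt pi * \<sigma> ^ 3 / sqrt (\<sigma> ^ 4 + t\<^sup>2)))"
  have M: "has_bochner_integral lborel M (sqrt pi * \<sigma> ^ 3 * arsinh (1 / \<sigma>))"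
  proof -
    have "((\<lambda>t. sqrt pi * \<sigma> ^ 3 * arsinh (t / \<sigma>\<^sup>2)) has_real_derivative
        sqrt pi * \<sigma> ^ 3 / sqrt (\<sigma> ^ 4 + t\<^sup>2)) (at t)" for t
    proof -
      have "sqrt (\<sigma> ^ 4 + t\<^sup>2) = sqrt ((\<sigma>\<^sup>2)\<^sup>2 * ((t / \<sigma>\<^sup>2)\<^sup>2 + 1))"
        using \<sigma> by (simp add: field_simps power_divide flip: power_mult)
      also have "\<dots> = \<sigma>\<^sup>2 * sqrt ((t / \<sigma>\<^sup>2)\<^sup>2 + 1)" by (simp only: real_sqrt_mult real_sqrt_abs abs_power2)
      finally have eq: "sqrt (\<sigma> ^ 4 + t\<^sup>2) = \<sigma>\<^sup>2 * sqrt ((t / \<sigma>\<^sup>2)\<^sup>2 + 1)" .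
      have "((\<lambda>t. arsinh (t / \<sigma>\<^sup>2)) has_real_derivative 1 / sqrt ((t / \<sigma>\<^sup>2)\<^sup>2 + 1) * (1 / \<sigma>\<^sup>2)) (at t)"
        by (intro DERIV_chain2[OF arsinh_real_has_field_derivative] DERIV_cdivide DERIV_ident)
      from DERIV_cmult[OF this, of "sqrt pi * \<sigma> ^ 3"] show ?thesis
        unfolding eq by (rule DERIV_cong) simp
    qed
    then have "has_bochner_integral lborel (\<lambda>t. sqrt pi * \<sigma> ^ 3 / sqrt (\<sigma> ^ 4 + t\<^sup>2) * indicator {0..\<sigma>} t)
      (sqrt pi * \<sigma> ^ 3 * arsinh (\<sigma> / \<sigma>\<^sup>2) - sqrt pi * \<sigma> ^ 3 * arsinh (0 / \<sigma>\<^sup>2))"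
      using \<sigma> by (intro has_bochner_integral_FTC_Icc_nonneg) auto
    then show ?thesis using \<sigma> by (simp add: M_def mult.commute power2_eq_square)
  qed
  \<comment> \<open>A majorant in time for both regimes. The two powers of \<open>t\<close>
    integrate to \<open>2 * \<sigma> powr (1/2)\<close> and \<open>2 * \<sigma> powr (-1/2)\<close>,
    so each part becomes a multiple of \<open>\<sigma> ^ 3\<close>.\<close>
  define E where "E = (\<lambda>t. indicator {0..\<sigma>} t * t powr (-1/2) * (G * 6 * \<sigma> powr (5/2)) +
      indicator {\<sigma>..} t * t powr (-3/2) * (A * 2 * \<sigma> powr (7/2)))"
  have E: "has_bochner_integral lborel E (12 * G * \<sigma> ^ 3 + 4 * A * \<sigma> ^ 3)"
  proof -
    have "has_bochner_integral lborel (\<lambda>t. indicator {0..\<sigma>} t * t powr (-1/2)) (\<sigma> powr (-1/2 + 1) / (-1/2 + 1))"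
      using \<sigma> by (intro has_bochner_integral_nonneg_has_integral has_integral_powr_from_0) auto
    moreover have "has_bochner_integral lborel (\<lambda>t. indicator {\<sigma>..} t * t powr (-3/2)) (- (\<sigma> powr (-3/2 + 1)) / (-3/2 + 1))"
      using \<sigma> by (intro has_bochner_integral_nonneg_has_integral has_integral_powr_to_inf) auto
    ultimately have "has_bochner_integral lborel E
       (\<sigma> powr (-1/2 + 1) / (-1/2 + 1) * (G * 6 * \<sigma> powr (5/2)) +
        - (\<sigma> powr (-3/2 + 1)) / (-3/2 + 1) * (A * 2 * \<sigma> powr (7/2)))"
      unfolding E_def by (intro has_bochner_integral_add has_bochner_integral_mult_left)
    moreover have "\<sigma> powr (1/2) * \<sigma> powr (5/2) = \<sigma> ^ 3" "\<sigma> powr (-1/2) * \<sigma> powr (7/2) = \<sigma> ^ 3"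
      using \<sigma> by (simp_all add: powr_numeral flip: powr_add)
    ultimately show ?thesis by (simp add: mult_ac)
  qed
  define J where "J = (\<lambda>t. indicator {0..} t *\<^sub>R I t)"
  \<comment> \<open>The near estimate needs positive time, and \<open>0 powr (-1/2)\<close> is 0;
    the single excluded point is a null set.\<close>
  have bound: "cmod (J t - of_real (M t) * b0) \<le> E t" if "t \<noteq> 0" for t
  proof -
    have "t < 0 \<or> (0 < t \<and> t \<le> \<sigma>) \<or> t > \<sigma>" using that by linarith
    then consider "t < 0" | "0 < t" "t \<le> \<sigma>" | "t > \<sigma>" by blast
    then show ?thesis
    proof cases
      case 1
      then show ?thesis using \<sigma> by (simp add: J_def M_def E_def)
    next
      case 2
      have "cmod (I t - of_real (sqrt pi * \<sigma> ^ 3 / sqrt (\<sigma> ^ 4 + t\<^sup>2)) * b0) \<le> G * (6 * \<sigma> powr (5/2) * t powr (-1/2))"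
        unfolding I_def b0_def G_def by (rule gauss_quartic_integral_near[OF \<sigma>(1) 2(1) a])
      \<comment> \<open>At \<open>t = \<sigma>\<close> both terms of \<open>E\<close> are active;
        the surplus one is nonnegative.\<close>
      also have "\<dots> \<le> E t" using 2 AGN by (simp add: E_def mult_ac)
      finally show ?thesis using 2 by (simp add: J_def M_def)
    next
      case 3
      then have "cmod (I t) \<le> A * (2 * \<sigma> powr (7/2) * t powr (-3/2))"
        unfolding I_def A_def using \<sigma> by (intro gauss_quartic_integral_far a2) auto
      then show ?thesis using 3 \<sigma> by (simp add: J_def M_def E_def mult_ac)
    qed
  qed
  have ae: "AE t in lborel. cmod (J t - of_real (M t) * b0) \<le> E t"
    using AE_lborel_singleton[of 0] by eventually_elim (rule bound)
  have Mb: "has_bochner_integral lborel (\<lambda>t. of_real (M t) * b0) (of_real (sqrt pi * \<sigma> ^ 3 * arsinh (1 / \<sigma>)) * b0)"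
    by (intro has_bochner_integral_mult_left has_bochner_integral_of_real M)
  \<comment> \<open>Integrability in time is not known beforehand for \<open>J\<close>; it is
    inherited from the error, which \<open>E\<close> dominates, and from the explicit main
    term.\<close>
  have D: "integrable lborel (\<lambda>t. J t - of_real (M t) * b0)"
  proof (rule Bochner_Integration.integrable_bound[OF integrable.intros[OF E]])
    show "(\<lambda>t. J t - of_real (M t) * b0) \<in> borel_measurable lborel"
      unfolding J_def M_def by measurable
    show "AE t in lborel. cmod (J t - of_real (M t) * b0) \<le> norm (E t)"
      using ae by eventually_elim simp
  qed
  have "cmod (LINT t|lborel. J t - of_real (M t) * b0) \<le> (LINT t|lborel. E t)"
    by (intro integral_norm_bound_AE D integrable.intros[OF E] ae)
  also have "\<dots> = 12 * G * \<sigma> ^ 3 + 4 * A * \<sigma> ^ 3" by (rule has_bochner_integral_integral_eq[OF E])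
  also have "\<dots> \<le> 12 * N * \<sigma> ^ 3 + 4 * N * \<sigma> ^ 3"
    using AGN \<sigma> by (intro add_mono mult_right_mono) auto
  finally have main: "cmod (LINT t|lborel. J t - of_real (M t) * b0) \<le> 16 * (\<sigma> ^ 3 * N)"
    by (simp add: mult.commute)
  have "(LINT t|lborel. J t) = (LINT t|lborel. (J t - of_real (M t) * b0) + of_real (M t) * b0)" by simp
  also have "\<dots> = (LINT t|lborel. J t - of_real (M t) * b0) + of_real (sqrt pi * \<sigma> ^ 3 * arsinh (1 / \<sigma>)) * b0"
    using D integrable.intros[OF Mb] has_bochner_integral_integral_eq[OF Mb]
    by (subst Bochner_Integration.integral_add) auto
  finally have "(LINT t|lborel. J t) - of_real (sqrt pi * \<sigma> ^ 3 * \<bar>ln \<sigma>\<bar>) * b0 =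
     (LINT t|lborel. J t - of_real (M t) * b0) + of_real (sqrt pi * \<sigma> ^ 3 * (arsinh (1 / \<sigma>) - \<bar>ln \<sigma>\<bar>)) * b0"
    by (simp add: algebra_simps)
  also have "cmod \<dots> \<le> 16 * (\<sigma> ^ 3 * N) + 8 * (\<sigma> ^ 3 * N)"
  proof (rule norm_triangle_le[OF add_mono[OF main]])
    define d where "d = arsinh (1 / \<sigma>) - \<bar>ln \<sigma>\<bar>"
    have "sqrt pi \<le> sqrt 4" using pi_less_4 by (intro real_sqrt_le_mono) simp
    then have "sqrt pi \<le> 2" by simp
    \<comment> \<open>Three factors 2 give the 8: from \<open>sqrt pi\<close>, from the comparison
      of \<open>arsinh\<close> with the logarithm, and from the pointwise bound on
      \<open>b0\<close>.\<close>
    then have "(sqrt pi * \<sigma> ^ 3 * \<bar>d\<bar>) * cmod b0 \<le> (2 * \<sigma> ^ 3 * 2) * (2 * N)"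
      using \<sigma> b0 arsinh_inverse_approx[OF \<sigma>] by (intro mult_mono) (auto simp: d_def)
    moreover have "cmod (of_real (sqrt pi * \<sigma> ^ 3 * d) * b0) = (sqrt pi * \<sigma> ^ 3 * \<bar>d\<bar>) * cmod b0"
      using \<sigma> by (simp only: norm_mult norm_of_real abs_mult) simp
    ultimately show "cmod (of_real (sqrt pi * \<sigma> ^ 3 * (arsinh (1 / \<sigma>) - \<bar>ln \<sigma>\<bar>)) * b0) \<le> 8 * (\<sigma> ^ 3 * N)"
      unfolding d_def[symmetric] by simp
  qed
  finally have "cmod ((LINT t|lborel. J t) - of_real (sqrt pi * \<sigma> ^ 3 * \<bar>ln \<sigma>\<bar>) * b0) \<le> 24 * (\<sigma> ^ 3 * N)"
    by (simp only: distrib_right[symmetric]) simp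
  then show "cmod ((LINT t:{0..}|lborel. (LINT x|lborel.
                a x * of_real (cmod (schroedinger t (gauss_scaled \<sigma> x0) x) ^ 4)))
            - of_real (sqrt pi * \<sigma> ^ 3 * \<bar>ln \<sigma>\<bar>) * continuous_rep a x0)
        \<le> 24 * (\<sigma> ^ 3 * H1_norm a)"
    unfolding cmod_schroedinger_gauss_scaled[OF \<sigma>(1)] set_lebesgue_integral_def
    by (simp add: J_def I_def gauss_quartic_def b0_def N_def)
qed auto

end
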